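(* Thompson's group $T$ has Serre's property FA.
   Context: Thompson's group $T$ is the group of piecewise linear orientation-preserving homeomorphisms of the circle $[0,1]/(0\sim 1)$ that map (images of) dyadic rational numbers to dyadic rational numbers, are differentiable except at finitely many points, all dyadic rationals, and whose derivative at every other point is a power $2^i$, $i\in\mathbb{Z}$. A group $G$ acting simplicially on a simplicial tree $\Gamma$ acts without inversions if, whenever $g\in G$ leaves an edge $e$ invariant, $g$ acts as the identity on $e$. All simplicial actions on trees are assumed to be without inversions (after barycentric subdivision of the tree if necessary). A group $G$ has (Serre's) property FA if every simplicial action of $G$ on a tree $\Gamma$ has a fixed point, i.e. there is some $v\in\Gamma$ with $G\cdot v=v$. *)

theory Defs
  imports "HOL-Analysis.Analysis" "HOL-Algebra.Group_Action"
begin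

section \<open>Thompson's group T\<close>

text \<open>The circle \<open>[0,1]/(0 \<sim> 1)\<close>: the underlying set is \<open>[0,1)\<close>, one representative of each
  class, the projection \<open>[0,1] \<rightarrow> [0,1)\<close> is \<^const>\<open>frac\<close> (it sends 1 to 0), and the topology is
  the quotient topology. Note that \<^const>\<open>frac\<close> is also the universal covering
  \<open>\<real> \<rightarrow> \<real>/\<int>\<close> of this circle.\<close>

definition circle :: "real set" where
  "circle = {0..<1}"

definition circle_topology :: "real topology" where
  "circle_topology = topology (\<lambda>U. U \<subseteq> circle \<and>
     openin (top_of_set {0..1}) {x \<in> {0..1}. frac x \<in> U})"

text \<open>\<^const>\<open>dyadics\<close> consists of the \<^emph>\<open>nonnegative\<close> dyadic rationals, which suffices on \<open>[0,1)\<close>.\<close>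

definition circle_dyadics :: "real set" where
  "circle_dyadics = circle \<inter> dyadics"

text \<open>A homeomorphism of the circle preserves the orientation iff it has an increasing lift to the
  universal cover; local properties (affine, differentiable, value of the derivative) of a circle
  map are, by definition, those of its lift.\<close>

definition orientation_preserving_lift :: "(real \<Rightarrow> real) \<Rightarrow> (real \<Rightarrow> real) \<Rightarrow> bool" where
  "orientation_preserving_lift g F \<longleftrightarrow>
     continuous_on UNIV F \<and> strict_mono F \<and> (\<forall>x. F (x + 1) = F x + 1) \<and>
     (\<forall>x. frac (F x) = g (frac x))"

text \<open>\<open>B\<close> is the finite set of exceptional points. The first conjunct says that the map is
  affine on every interval of the circle avoiding \<open>B\<close>.\<close>

definition dyadic_PL_off :: "real set \<Rightarrow> (real \<Rightarrow> real) \<Rightarrow> bool" where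
  "dyadic_PL_off B F \<longleftrightarrow>
     (\<forall>a b. (\<forall>x \<in> {a<..<b}. frac x \<notin> B) \<longrightarrow> (\<exists>c d. \<forall>x \<in> {a<..<b}. F x = c * x + d)) \<and>
     (\<forall>x. frac x \<notin> B \<longrightarrow> (\<exists>i::int. (F has_real_derivative 2 powi i) (at x)))"

text \<open>The elements are extensional functions on \<open>[0,1)\<close>, so that each circle map is represented
  exactly once.\<close>

definition thompson_T_maps :: "(real \<Rightarrow> real) set" where
  "thompson_T_maps = {g \<in> Bij circle.
     homeomorphic_map circle_topology circle_topology g \<and>
     g ` circle_dyadics \<subseteq> circle_dyadics \<and>
     (\<exists>F B. orientation_preserving_lift g F \<and> finite B \<and> B \<subseteq> circle_dyadics \<and>
        dyadic_PL_off B F)}"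

definition thompson_T :: "(real \<Rightarrow> real) monoid" where
  "thompson_T = BijGroup circle \<lparr>carrier := thompson_T_maps\<rparr>"


section \<open>Trees and property FA\<close>

text \<open>A simplicial tree, as an abstract one-dimensional simplicial complex: vertex set \<open>V\<close> and
  set \<open>E\<close> of edges, the edges being two-element sets of vertices. No finiteness or local
  finiteness is assumed.\<close>

definition simplicial_graph :: "'v set \<Rightarrow> 'v set set \<Rightarrow> bool" where
  "simplicial_graph V E \<longleftrightarrow> (\<forall>e \<in> E. \<exists>u \<in> V. \<exists>v \<in> V. u \<noteq> v \<and> e = {u, v})"

definition edge_path :: "'v set \<Rightarrow> 'v set set \<Rightarrow> 'v list \<Rightarrow> bool" where
  "edge_path V E p \<longleftrightarrow> p \<noteq> [] \<and> set p \<subseteq> V \<and> successively (\<lambda>u v. {u, v} \<in> E) p"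

definition graph_connected :: "'v set \<Rightarrow> 'v set set \<Rightarrow> bool" where
  "graph_connected V E \<longleftrightarrow> (\<forall>u \<in> V. \<forall>v \<in> V. \<exists>p. edge_path V E p \<and> hd p = u \<and> last p = v)"

definition circuit :: "'v set \<Rightarrow> 'v set set \<Rightarrow> 'v list \<Rightarrow> bool" where
  "circuit V E p \<longleftrightarrow> edge_path V E p \<and> distinct p \<and> length p \<ge> 3 \<and> {last p, hd p} \<in> E"

definition simplicial_tree :: "'v set \<Rightarrow> 'v set set \<Rightarrow> bool" where
  "simplicial_tree V E \<longleftrightarrow>
     simplicial_graph V E \<and> V \<noteq> {} \<and> graph_connected V E \<and> (\<nexists>p. circuit V E p)"

definition simplicial_action ::
    "('g, 'm) monoid_scheme \<Rightarrow> 'v set \<Rightarrow> 'v set set \<Rightarrow> ('g \<Rightarrow> 'v \<Rightarrow> 'v) \<Rightarrow> bool" where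
  "simplicial_action G V E \<phi> \<longleftrightarrow>
     group_action G V \<phi> \<and> (\<forall>g \<in> carrier G. \<forall>e \<in> E. \<phi> g ` e \<in> E)"

text \<open>A simplicial automorphism is determined on the closed edge \<open>e\<close> by its effect on the two
  endpoints, so acting as the identity on \<open>e\<close> means fixing both.\<close>

definition without_inversions ::
    "('g, 'm) monoid_scheme \<Rightarrow> 'v set set \<Rightarrow> ('g \<Rightarrow> 'v \<Rightarrow> 'v) \<Rightarrow> bool" where
  "without_inversions G E \<phi> \<longleftrightarrow>
     (\<forall>g \<in> carrier G. \<forall>e \<in> E. \<phi> g ` e = e \<longrightarrow> (\<forall>v \<in> e. \<phi> g v = v))"

text \<open>HOL cannot quantify over types inside a formula, so the type of vertices is an explicit
  parameter; a statement with a free \<open>'v\<close> covers all trees.\<close>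

definition property_FA :: "'v itself \<Rightarrow> ('g, 'm) monoid_scheme \<Rightarrow> bool" where
  "property_FA _ G \<longleftrightarrow>
     (\<forall>(V :: 'v set) E \<phi>.
        simplicial_tree V E \<and> simplicial_action G V E \<phi> \<and> without_inversions G E \<phi> \<longrightarrow>
        (\<exists>v \<in> V. \<forall>g \<in> carrier G. \<phi> g v = v))"


section \<open>The circle carries the quotient topology\<close>

lemma istopology_circle:
  "istopology (\<lambda>U. U \<subseteq> circle \<and> openin (top_of_set {0..1::real}) {x \<in> {0..1}. frac x \<in> U})"
  unfolding istopology_def
proof (intro conjI allI impI)
  fix S T :: "real set"
  assume S: "S \<subseteq> circle \<and> openin (top_of_set {0..1}) {x \<in> {0..1}. frac x \<in> S}"
    and T: "T \<subseteq> circle \<and> openin (top_of_set {0..1}) {x \<in> {0..1}. frac x \<in> T}"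
  have "{x \<in> {0..1}. frac x \<in> S \<inter> T} = {x \<in> {0..1}. frac x \<in> S} \<inter> {x \<in> {0..1::real}. frac x \<in> T}"
    by auto
  moreover have "openin (top_of_set {0..1})
      ({x \<in> {0..1}. frac x \<in> S} \<inter> {x \<in> {0..1::real}. frac x \<in> T})"
    by (rule openin_Int) (use S T in blast)+
  ultimately show "openin (top_of_set {0..1}) {x \<in> {0..1}. frac x \<in> S \<inter> T}"
    by (simp only:)
  show "S \<inter> T \<subseteq> circle" using S by auto
next
  fix K :: "real set set"
  assume K: "\<forall>S\<in>K. S \<subseteq> circle \<and> openin (top_of_set {0..1}) {x \<in> {0..1}. frac x \<in> S}"
  have "{x \<in> {0..1}. frac x \<in> \<Union>K} = (\<Union>S\<in>K. {x \<in> {0..1::real}. frac x \<in> S})"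
    by auto
  moreover have "openin (top_of_set {0..1}) (\<Union>S\<in>K. {x \<in> {0..1::real}. frac x \<in> S})"
    by (rule openin_Union) (use K in blast)
  ultimately show "openin (top_of_set {0..1}) {x \<in> {0..1}. frac x \<in> \<Union>K}"
    by (simp only:)
  show "\<Union>K \<subseteq> circle" using K by auto
qed

lemma openin_circle_topology:
  "openin circle_topology U \<longleftrightarrow>
     U \<subseteq> circle \<and> openin (top_of_set {0..1}) {x \<in> {0..1}. frac x \<in> U}"
  unfolding circle_topology_def topology_inverse'[OF istopology_circle] ..

lemma frac_in_circle [simp]: "frac (x::real) \<in> circle"
  by (simp add: circle_def frac_lt_1)

lemma frac_circle [simp]: "x \<in> circle \<Longrightarrow> frac x = x"
  by (simp add: circle_def frac_eq)

lemma topspace_circle [simp]: "topspace circle_topology = circle"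
proof -
  have "{x \<in> {0..1::real}. frac x \<in> circle} = {0..1}" by auto
  then have "openin circle_topology circle"
    unfolding openin_circle_topology by (simp only: openin_subtopology_self order_refl simp_thms)
  then show ?thesis
    by (metis openin_circle_topology openin_subset openin_topspace subset_antisym)
qed

lemma quotient_map_circle: "quotient_map (top_of_set {0..1}) circle_topology frac"
proof -
  have "frac ` {0..1::real} = circle"
  proof
    show "circle \<subseteq> frac ` {0..1::real}"
    proof
      fix t assume "t \<in> circle"
      then have "t = frac t" "t \<in> {0..1}" by (auto simp: circle_def)
      then show "t \<in> frac ` {0..1}" by (rule image_eqI)
    qed
  qed auto
  then show ?thesis
    by (simp add: quotient_map_def openin_circle_topology)
qed


section \<open>Thompson's T is a group\<close>

definition dyadic_rationals :: "real set" where
  "dyadic_rationals = {of_int m / 2 ^ k | m k. True}"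

lemma dyadicsI [intro]: "of_int m / 2 ^ k \<in> dyadic_rationals"
  by (auto simp: dyadic_rationals_def)

lemma circle_dyadics_iff: "x \<in> circle_dyadics \<longleftrightarrow> x \<in> circle \<and> x \<in> dyadic_rationals"
proof (intro iffI conjI)
  assume x: "x \<in> circle_dyadics"
  then show "x \<in> circle" by (simp add: circle_dyadics_def)
  from x obtain m k where "x = of_nat m / 2 ^ k"
    by (auto simp: circle_dyadics_def dyadics_def)
  then show "x \<in> dyadic_rationals" using dyadicsI[of "int m" k] by simp
next
  assume "x \<in> circle \<and> x \<in> dyadic_rationals"
  then obtain m k where x: "x = of_int m / 2 ^ k" "x \<in> circle"
    by (auto simp: dyadic_rationals_def)
  then have "0 \<le> of_int m / (2 ^ k :: real)" by (simp add: circle_def)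
  moreover have "0 < (2 ^ k :: real)" by simp
  ultimately have "0 \<le> m" by (metis divide_less_0_iff not_le of_int_less_0_iff)
  then have "x = of_nat (nat m) / 2 ^ k" using x by simp
  then show "x \<in> circle_dyadics" using x unfolding circle_dyadics_def dyadics_def by blast
qed

lemma dyadic_add: "x \<in> dyadic_rationals \<Longrightarrow> y \<in> dyadic_rationals \<Longrightarrow> x + y \<in> dyadic_rationals"
proof -
  assume "x \<in> dyadic_rationals" "y \<in> dyadic_rationals"
  then obtain m k n l where "x = of_int m / 2 ^ k" "y = of_int n / 2 ^ l"
    by (auto simp: dyadic_rationals_def)
  then have "x + y = of_int (m * 2 ^ l + n * 2 ^ k) / 2 ^ (k + l)"
    by (simp add: add_divide_distrib power_add)
  then show ?thesis by (metis dyadicsI)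
qed

lemma dyadic_mult: "x \<in> dyadic_rationals \<Longrightarrow> y \<in> dyadic_rationals \<Longrightarrow> x * y \<in> dyadic_rationals"
proof -
  assume "x \<in> dyadic_rationals" "y \<in> dyadic_rationals"
  then obtain m k n l where "x = of_int m / 2 ^ k" "y = of_int n / 2 ^ l"
    by (auto simp: dyadic_rationals_def)
  then have "x * y = of_int (m * n) / 2 ^ (k + l)"
    by (simp add: power_add)
  then show ?thesis by (metis dyadicsI)
qed

lemma dyadic_int: "of_int m \<in> dyadic_rationals"
  using dyadicsI[of m 0] by simp

lemma dyadic_diff: "x \<in> dyadic_rationals \<Longrightarrow> y \<in> dyadic_rationals \<Longrightarrow> x - y \<in> dyadic_rationals"
  using dyadic_add[of x "of_int (-1) * y"] dyadic_mult[OF dyadic_int[of "-1"], of y] by simp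

lemma dyadic_powi: "2 powi i \<in> dyadic_rationals"
proof (cases "i \<ge> 0")
  case True
  then have "2 powi i = (of_int (2 ^ nat i) :: real)" by (simp add: power_int_def)
  then show ?thesis by (metis dyadic_int)
next
  case False
  then have "2 powi i = (of_int 1 / 2 ^ nat (- i) :: real)"
    by (simp add: power_int_def field_simps)
  then show ?thesis by (metis dyadicsI)
qed

lemma frac_dyadic_iff: "frac x \<in> dyadic_rationals \<longleftrightarrow> x \<in> dyadic_rationals"
proof
  assume "frac x \<in> dyadic_rationals"
  from dyadic_add[OF this dyadic_int[of "\<lfloor>x\<rfloor>"]] show "x \<in> dyadic_rationals"
    by (simp add: frac_def)
next
  assume "x \<in> dyadic_rationals"
  from dyadic_diff[OF this dyadic_int[of "\<lfloor>x\<rfloor>"]] show "frac x \<in> dyadic_rationals"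
    by (simp add: frac_def)
qed

lemma frac_dyadics_iff: "frac x \<in> circle_dyadics \<longleftrightarrow> x \<in> dyadic_rationals"
  by (simp add: circle_dyadics_iff frac_dyadic_iff)

lemma closed_frac_vimage:
  assumes "finite B"
  shows "closed {x::real. frac x \<in> B}"
proof -
  have "{x::real. frac x \<in> B} = (\<Union>b\<in>B \<inter> circle. (+) b ` \<int>)"
  proof (intro subset_antisym subsetI)
    fix x :: real assume "x \<in> {x. frac x \<in> B}"
    moreover have "x = frac x + of_int \<lfloor>x\<rfloor>" by (simp add: frac_def)
    then have "x \<in> (+) (frac x) ` \<int>" by (metis Ints_of_int image_eqI)
    ultimately show "x \<in> (\<Union>b\<in>B \<inter> circle. (+) b ` \<int>)" by auto
  next
    fix x :: real assume "x \<in> (\<Union>b\<in>B \<inter> circle. (+) b ` \<int>)"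
    then show "x \<in> {x. frac x \<in> B}" by (auto simp: frac_add_int_right)
  qed
  moreover have "closed (\<Union>b\<in>B \<inter> circle. (+) b ` (\<int> :: real set))"
    using assms by (intro closed_UN) (auto intro: closed_translation)
  ultimately show ?thesis by simp
qed

lemma dyadic_between:
  assumes "(a::real) < b"
  obtains s where "s \<in> dyadic_rationals" "a < s" "s < b"
proof -
  obtain n q r where *: "of_int q / 2 ^ n < a" "a < of_int r / 2 ^ n"
      "\<bar>of_int q / 2 ^ n - of_int r / 2 ^ n\<bar> < b - a"
    using padic_rational_approximation_straddle[of "b - a" 2 a] assms
    by (metis diff_gt_0_iff_gt one_less_numeral_iff semiring_norm(76))
  show thesis
    by (rule that[of "of_int r / 2 ^ n"]) (use * in auto)
qed

lemma lift_surj: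
  assumes "orientation_preserving_lift g F" "g ` circle = circle"
  shows "surj F"
proof (rule surjI)
  fix y :: real
  have shift: "F (x + of_int n) = F x + of_int n" for x n
  proof (induction n arbitrary: x rule: int_induct[where k = 0])
    case (step1 i)
    have "F (x + of_int (i + 1)) = F ((x + of_int i) + 1)" by (simp add: add.assoc)
    also have "\<dots> = F (x + of_int i) + 1"
      using assms by (simp add: orientation_preserving_lift_def)
    finally show ?case using step1 by simp
  next
    case (step2 i)
    have "F (x + of_int i) = F ((x + of_int (i - 1)) + 1)" by simp
    also have "\<dots> = F (x + of_int (i - 1)) + 1"
      using assms unfolding orientation_preserving_lift_def by blast
    finally show ?case using step2 by simp
  qed simp
  obtain t where t: "t \<in> circle" "g t = frac y"
    using assms(2) by (metis frac_in_circle imageE)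
  then have "frac (F t) = frac y"
    using assms by (simp add: orientation_preserving_lift_def)
  then have "y = F t + of_int (\<lfloor>y\<rfloor> - \<lfloor>F t\<rfloor>)" by (simp add: frac_def)
  then have "\<exists>x. F x = y" by (metis shift)
  then show "F (SOME x. F x = y) = y" by (rule someI_ex)
qed

lemma thompson_T_one: "(\<lambda>x\<in>circle. x) \<in> thompson_T_maps"
proof -
  have "homeomorphic_map circle_topology circle_topology (\<lambda>x\<in>circle. x)"
    by (rule homeomorphic_map_eq[of _ _ id]) auto
  moreover have "orientation_preserving_lift (\<lambda>x\<in>circle. x) (\<lambda>x. x)"
    by (simp add: orientation_preserving_lift_def strict_mono_def)
  moreover have "dyadic_PL_off {} (\<lambda>x. x)"
    unfolding dyadic_PL_off_def
  proof (intro conjI allI impI)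
    show "\<exists>c d. \<forall>x\<in>{a<..<b}. x = c * x + d" for a b :: real
      by (intro exI[of _ 1] exI[of _ 0]) auto
    show "\<exists>i. ((\<lambda>x. x) has_real_derivative 2 powi i) (at x)" for x
      by (intro exI[of _ 0]) (auto intro!: derivative_eq_intros)
  qed
  moreover have "(\<lambda>x\<in>circle. x) ` circle_dyadics \<subseteq> circle_dyadics"
    by (auto simp: circle_dyadics_def)
  ultimately show ?thesis
    unfolding thompson_T_maps_def by (auto simp: id_Bij intro!: exI[of _ "{}"])
qed

lemma lift_interval_image:
  assumes "orientation_preserving_lift g F" "surj F" "y \<in> {F a<..<F b}"
  obtains x where "x \<in> {a<..<b}" "y = F x"
proof -
  obtain x where "y = F x" using assms(2) by (metis surjD)
  then show thesis
    using assms that[of x] by (auto simp: orientation_preserving_lift_def strict_mono_less)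
qed

lemma thompson_T_reflects_dyadic:
  assumes g: "g \<in> thompson_T_maps" and t: "t \<in> circle" "g t \<in> circle_dyadics"
  shows "t \<in> circle_dyadics"
proof -
  obtain F B where F: "orientation_preserving_lift g F" "finite B" "B \<subseteq> circle_dyadics"
      "dyadic_PL_off B F"
    using g unfolding thompson_T_maps_def by auto
  have gD: "g ` circle_dyadics \<subseteq> circle_dyadics"
    using g by (auto simp: thompson_T_maps_def)
  have fF: "frac (F x) = g (frac x)" for x
    using F(1) by (simp add: orientation_preserving_lift_def)
  show ?thesis
  proof (cases "t \<in> B")
    case True
    then show ?thesis using F(3) by auto
  next
    case False
    have "open (- {x::real. frac x \<in> B})"
      using closed_frac_vimage[OF F(2)] by (simp add: open_Compl)
    moreover have "t \<in> - {x::real. frac x \<in> B}" using t False by simp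
    ultimately obtain e where e: "e > 0" "ball t e \<subseteq> - {x::real. frac x \<in> B}"
      by (meson openE)
    have "\<forall>x\<in>{t - e<..<t + e}. frac x \<notin> B"
      using e(2) by (auto simp: ball_eq_greaterThanLessThan)
    then obtain c d where cd: "\<forall>x\<in>{t - e<..<t + e}. F x = c * x + d"
      using F(4) unfolding dyadic_PL_off_def by meson
    obtain i where i: "(F has_real_derivative 2 powi i) (at t)"
      using F(4) False t(1) unfolding dyadic_PL_off_def by (metis frac_circle)
    have "((\<lambda>x. c * x + d) has_real_derivative c) (at t)"
      by (auto intro!: derivative_eq_intros)
    then have "(F has_real_derivative c) (at t)"
      by (rule has_field_derivative_transform_within_open[of _ _ _ "{t - e<..<t + e}"])
        (use cd e(1) in auto)
    then have c: "c = 2 powi i" using i by (rule DERIV_unique)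
    obtain s where s: "s \<in> dyadic_rationals" "t < s" "s < t + e"
      using dyadic_between[of t "t + e"] e(1) by auto
    have "frac (F s) \<in> circle_dyadics"
      using gD s(1) by (auto simp: fF frac_dyadics_iff)
    then have Fs: "F s \<in> dyadic_rationals" by (simp add: frac_dyadics_iff)
    have "frac (F t) \<in> circle_dyadics" using t by (simp add: fF)
    then have Ft: "F t \<in> dyadic_rationals" by (simp add: frac_dyadics_iff)
    have eq: "F s - F t = 2 powi i * (s - t)"
      using cd s e(1) c by (simp add: algebra_simps)
    have "2 powi (- i) * (F s - F t) = (2 powi (- i) * 2 powi i) * (s - t)"
      unfolding eq by simp
    also have "2 powi (- i) * 2 powi i = (1::real)"
      by (simp add: power_int_minus)
    finally have "t = s - 2 powi (- i) * (F s - F t)" by simp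
    moreover have "s - 2 powi (- i) * (F s - F t) \<in> dyadic_rationals"
      by (intro dyadic_diff dyadic_mult s dyadic_powi Fs Ft)
    ultimately show ?thesis using t(1) by (simp add: circle_dyadics_iff)
  qed
qed

lemma thompson_T_compose:
  assumes g: "g \<in> thompson_T_maps" and h: "h \<in> thompson_T_maps"
  shows "compose circle g h \<in> thompson_T_maps"
proof -
  obtain F B where F: "orientation_preserving_lift g F" "finite B" "B \<subseteq> circle_dyadics"
      "dyadic_PL_off B F"
    using g unfolding thompson_T_maps_def by auto
  obtain H C where H: "orientation_preserving_lift h H" "finite C" "C \<subseteq> circle_dyadics"
      "dyadic_PL_off C H"
    using h unfolding thompson_T_maps_def by auto
  have gB: "g \<in> Bij circle" and hB: "h \<in> Bij circle"
    using g h by (auto simp: thompson_T_maps_def)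
  have him: "h ` circle = circle" and hinj: "inj_on h circle"
    using hB by (auto simp: Bij_def bij_betw_def)
  have hD: "h ` circle_dyadics \<subseteq> circle_dyadics" and gD: "g ` circle_dyadics \<subseteq> circle_dyadics"
    using g h by (auto simp: thompson_T_maps_def)
  have Hs: "surj H" using lift_surj[OF H(1) him] .
  have fH: "frac (H x) = h (frac x)" for x
    using H(1) by (simp add: orientation_preserving_lift_def)
  have Hm: "strict_mono H" using H(1) by (simp add: orientation_preserving_lift_def)
  have homeo: "homeomorphic_map circle_topology circle_topology (compose circle g h)"
  proof (rule homeomorphic_map_eq)
    show "homeomorphic_map circle_topology circle_topology (g \<circ> h)"
      using g h by (intro homeomorphic_map_compose) (auto simp: thompson_T_maps_def)
  qed (simp add: compose_def)
  have lift: "orientation_preserving_lift (compose circle g h) (F \<circ> H)"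
    using F(1) H(1) unfolding orientation_preserving_lift_def
    by (auto simp: compose_def strict_mono_def o_def intro: continuous_on_compose2)
  define D where "D = {t \<in> circle. t \<in> C \<or> h t \<in> B}"
  have "finite {t \<in> circle. h t \<in> B}"
    using finite_vimage_IntI[OF F(2) hinj] by (simp add: vimage_def Int_def conj_commute)
  then have finD: "finite D"
    using H(2) by (auto simp: D_def intro: finite_subset[of _ "C \<union> {t \<in> circle. h t \<in> B}"])
  have "D \<subseteq> circle_dyadics"
    using thompson_T_reflects_dyadic[OF h] F(3) H(3) by (auto simp: D_def)
  moreover have "dyadic_PL_off D (F \<circ> H)"
    unfolding dyadic_PL_off_def
  proof (intro conjI allI impI)
    fix a b :: real assume ab: "\<forall>x\<in>{a<..<b}. frac x \<notin> D"
    then have "\<forall>x\<in>{a<..<b}. frac x \<notin> C" by (auto simp: D_def)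
    then obtain c d where cd: "\<forall>x\<in>{a<..<b}. H x = c * x + d"
      using H(4) unfolding dyadic_PL_off_def by meson
    have "frac y \<notin> B" if "y \<in> {H a<..<H b}" for y
      by (rule lift_interval_image[OF H(1) Hs that])
        (use ab in \<open>auto simp: D_def fH\<close>)
    then obtain c' d' where cd': "\<forall>y\<in>{H a<..<H b}. F y = c' * y + d'"
      using F(4) unfolding dyadic_PL_off_def by meson
    have "(F \<circ> H) x = (c' * c) * x + (c' * d + d')" if "x \<in> {a<..<b}" for x
    proof -
      have "H x \<in> {H a<..<H b}" using that Hm by (auto simp: strict_mono_less)
      then show ?thesis using cd cd' that by (simp add: algebra_simps)
    qed
    then show "\<exists>c d. \<forall>x\<in>{a<..<b}. (F \<circ> H) x = c * x + d" by blast
  next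
    fix x :: real assume x: "frac x \<notin> D"
    then obtain i where i: "(H has_real_derivative 2 powi i) (at x)"
      using H(4) unfolding dyadic_PL_off_def by (auto simp: D_def)
    have "frac (H x) \<notin> B" using x by (auto simp: D_def fH)
    then obtain j where "(F has_real_derivative 2 powi j) (at (H x))"
      using F(4) unfolding dyadic_PL_off_def by blast
    from DERIV_chain[OF this i]
    have "((F \<circ> H) has_real_derivative 2 powi (j + i)) (at x)"
      by (simp add: power_int_add)
    then show "\<exists>i. ((F \<circ> H) has_real_derivative 2 powi i) (at x)" by blast
  qed
  moreover have "compose circle g h ` circle_dyadics \<subseteq> circle_dyadics"
    using gD hD by (force simp: compose_def circle_dyadics_def)
  ultimately show ?thesis
    using homeo lift finD gB hB by (auto simp: thompson_T_maps_def compose_Bij)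
qed

lemma thompson_T_inverse:
  assumes g: "g \<in> thompson_T_maps"
  shows "(\<lambda>x\<in>circle. inv_into circle g x) \<in> thompson_T_maps"
proof -
  let ?h = "\<lambda>x\<in>circle. inv_into circle g x"
  obtain F B where F: "orientation_preserving_lift g F" "finite B" "B \<subseteq> circle_dyadics"
      "dyadic_PL_off B F"
    using g unfolding thompson_T_maps_def by auto
  have gB: "g \<in> Bij circle" using g by (auto simp: thompson_T_maps_def)
  then have gim: "g ` circle = circle" and ginj: "inj_on g circle"
    by (auto simp: Bij_def bij_betw_def)
  have gD: "g ` circle_dyadics \<subseteq> circle_dyadics"
    using g by (auto simp: thompson_T_maps_def)
  have hB: "?h \<in> Bij circle" by (rule restrict_inv_into_Bij[OF gB])
  have gh: "g (?h y) = y" "?h y \<in> circle" if "y \<in> circle" for y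
    using that gim by (auto simp: f_inv_into_f inv_into_into)
  have hg: "?h (g x) = x" if "x \<in> circle" for x
    using that gim ginj by (auto simp: inv_into_f_f)
  have homeo: "homeomorphic_map circle_topology circle_topology ?h"
  proof -
    obtain k where k: "homeomorphic_maps circle_topology circle_topology g k"
      using g by (auto simp: thompson_T_maps_def homeomorphic_map_maps)
    then have kh: "homeomorphic_map circle_topology circle_topology k"
      and kg: "\<forall>x\<in>circle. k (g x) = x"
      by (auto simp: homeomorphic_maps_map)
    show ?thesis
    proof (rule homeomorphic_map_eq[OF kh])
      show "k y = ?h y" if "y \<in> topspace circle_topology" for y
        using that kg gh[of y] by (metis topspace_circle)
    qed
  qed
  have Fs: "surj F" by (rule lift_surj[OF F(1) gim])
  have Fm: "strict_mono F" and Fc: "continuous_on UNIV F" and F1: "F (x + 1) = F x + 1"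
    and fF: "frac (F x) = g (frac x)" for x
    using F(1) by (auto simp: orientation_preserving_lift_def)
  have Fi: "inj F" using Fm by (rule strict_mono_imp_inj_on)
  let ?G = "inv_into UNIV F"
  have FG: "F (?G y) = y" for y using Fs by (simp add: surj_f_inv_f)
  have GF: "?G (F x) = x" for x using Fi by simp
  have Gm: "strict_mono ?G"
    using Fm FG by (metis (no_types, lifting) strict_mono_def strict_mono_less)
  have Gc: "continuous_on UNIV ?G"
  proof (rule continuous_onI_mono)
    show "open (range ?G)" using Fi by (simp add: inj_imp_surj_inv)
    show "?G x \<le> ?G y" if "x \<le> y" for x y
      using that Gm by (simp add: strict_mono_less_eq)
  qed
  have G1: "?G (y + 1) = ?G y + 1" for y
    by (metis F1 FG GF)
  have fG: "frac (?G y) = ?h (frac y)" for y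
    by (metis fF FG hg frac_in_circle)
  have lift: "orientation_preserving_lift ?h ?G"
    unfolding orientation_preserving_lift_def using Gc Gm G1 fG by blast
  have BD: "g ` B \<subseteq> circle_dyadics" using F(3) gD by auto
  have Bc: "B \<subseteq> circle" using F(3) by (auto simp: circle_dyadics_def)
  have FB: "frac x \<in> B \<Longrightarrow> frac (F x) \<in> g ` B" for x by (simp add: fF)
  have "dyadic_PL_off (g ` B) ?G"
    unfolding dyadic_PL_off_def
  proof (intro conjI allI impI)
    fix a b :: real assume ab: "\<forall>y\<in>{a<..<b}. frac y \<notin> g ` B"
    have "\<forall>x\<in>{?G a<..<?G b}. frac x \<notin> B"
    proof
      fix x assume "x \<in> {?G a<..<?G b}"
      then have "F x \<in> {a<..<b}" using Fm FG
        by (metis greaterThanLessThan_iff strict_mono_less)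
      then show "frac x \<notin> B" using ab FB by blast
    qed
    then obtain c d where cd: "\<forall>x\<in>{?G a<..<?G b}. F x = c * x + d"
      using F(4) unfolding dyadic_PL_off_def by meson
    have Gin: "?G y \<in> {?G a<..<?G b}" if "y \<in> {a<..<b}" for y
      using that Gm by (auto simp: strict_mono_less)
    then have e: "y = c * ?G y + d" if "y \<in> {a<..<b}" for y
      using cd that FG by metis
    show "\<exists>c d. \<forall>y\<in>{a<..<b}. ?G y = c * y + d"
    proof (cases "c = 0")
      case True
      have False if "a < b"
      proof -
        have "(2 * a + b) / 3 = (a + 2 * b) / 3"
          using e[of "(2 * a + b) / 3"] e[of "(a + 2 * b) / 3"] True that by auto
        then show False using that by simp
      qed
      then show ?thesis by force
    next
      case False
      have "?G y = (1 / c) * y + (- d / c)" if "y \<in> {a<..<b}" for y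
        using e[OF that] False by (simp add: field_simps)
      then show ?thesis by blast
    qed
  next
    fix y :: real assume y: "frac y \<notin> g ` B"
    then have "frac (?G y) \<notin> B" using FB FG by metis
    then obtain i where "(F has_real_derivative 2 powi i) (at (?G y))"
      using F(4) unfolding dyadic_PL_off_def by blast
    then have "(?G has_real_derivative inverse (2 powi i)) (at y)"
      by (rule DERIV_inverse_function[where a = "y - 1" and b = "y + 1"])
        (use FG Gc in \<open>auto simp: continuous_on_eq_continuous_at\<close>)
    then show "\<exists>i. (?G has_real_derivative 2 powi i) (at y)"
      by (metis power_int_minus)
  qed
  moreover have "?h ` circle_dyadics \<subseteq> circle_dyadics"
  proof
    fix t assume "t \<in> ?h ` circle_dyadics"
    then obtain y where y: "y \<in> circle_dyadics" "t = ?h y" by blast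
    then have "y \<in> circle" by (simp add: circle_dyadics_def)
    then show "t \<in> circle_dyadics"
      using thompson_T_reflects_dyadic[OF g, of t] gh[of y] y by simp
  qed
  moreover have "finite (g ` B)" using F(2) by simp
  ultimately show ?thesis
    unfolding thompson_T_maps_def mem_Collect_eq using homeo lift hB BD by meson
qed

lemma subgroup_thompson_T: "subgroup thompson_T_maps (BijGroup circle)"
proof
  have sub: "thompson_T_maps \<subseteq> Bij circle" by (auto simp: thompson_T_maps_def)
  then show "thompson_T_maps \<subseteq> carrier (BijGroup circle)"
    by (simp add: BijGroup_def)
  show "\<one>\<^bsub>BijGroup circle\<^esub> \<in> thompson_T_maps"
    using thompson_T_one by (simp add: BijGroup_def)
  show "x \<otimes>\<^bsub>BijGroup circle\<^esub> y \<in> thompson_T_maps"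
    if "x \<in> thompson_T_maps" "y \<in> thompson_T_maps" for x y
    using thompson_T_compose[OF that] that sub by (auto simp: BijGroup_def)
  show "inv\<^bsub>BijGroup circle\<^esub> x \<in> thompson_T_maps" if "x \<in> thompson_T_maps" for x
    using thompson_T_inverse[OF that] that sub by (auto simp: inv_BijGroup)
qed

lemma group_thompson_T: "group thompson_T"
  unfolding thompson_T_def
  by (rule subgroup.subgroup_is_group[OF subgroup_thompson_T group_BijGroup])

end

theory Submission
  imports Defs "HOL-Algebra.Generated_Groups"
begin

text \<open>\<open>T\<close> is generated by two torsion elements \<open>\<alpha>\<close> and \<open>\<beta>\<close> with \<open>\<alpha>\<^sup>4 = \<beta>\<^sup>3 = (\<beta>\<alpha>)\<^sup>5 = 1\<close> (Lochak and Schneps):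
  they rotate the leaves of binary subdivisions of the circle into four and three intervals, and
  their product rotates a subdivision into five. An automorphism of finite order of a tree without
  inversions fixes a vertex. If \<open>t\<close> fixes a vertex, then it fixes the midpoint of the path from \<open>c\<close>
  to \<open>t c\<close>, for every vertex \<open>c\<close>. Hence, if \<open>s\<close>, \<open>t\<close> and \<open>s t\<close> fix vertices and \<open>s t c = c\<close>, then \<open>t\<close> and
  \<open>s\<^sup>-\<^sup>1\<close> have a common fixed vertex, because both move \<open>c\<close> to \<open>t c\<close>.

  For the generation, consider the groupoid of maps \<open>\<real>/n\<int> \<rightarrow> \<real>/m\<int>\<close> generated by translations by
  \<open>1\<close> and by the maps that stretch one unit interval to length two. Every element of \<open>T\<close> is a
  composition of these; and since splitting two leaves commutes, the translations of \<open>\<real>/3\<int>\<close>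
  and \<open>\<real>/4\<int>\<close> together with the splittings of the first leaf generate all of them.\<close>

section \<open>Reduced paths in trees\<close>

text \<open>Paths without backtracking. The condition involves only three consecutive entries, so it
  can be checked at a join and is kept by injective maps; in a tree it already forces the vertices
  to be distinct.\<close>

fun reduced :: "'v list \<Rightarrow> bool" where
  "reduced (x # y # z # zs) \<longleftrightarrow> x \<noteq> z \<and> reduced (y # z # zs)"
| "reduced _ \<longleftrightarrow> True"

lemma reduced_ConsD: "reduced (x # xs) \<Longrightarrow> reduced xs"
  by (cases xs rule: reduced.cases) auto

text \<open>Every triple of consecutive entries lies in one of the two parts, except the triple
  centred at \<open>m\<close>, which the third assumption covers.\<close>

lemma reduced_glue:
  assumes "reduced (xs @ [m])" "reduced (m # ys)"
    and "xs \<noteq> [] \<Longrightarrow> ys \<noteq> [] \<Longrightarrow> last xs \<noteq> hd ys"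
  shows "reduced (xs @ m # ys)"
  using assms
proof (induction xs rule: reduced.induct)
  case (1 x y z zs)
  then show ?case by simp
next
  case ("2_2" x)
  then show ?case by (cases ys) auto
next
  case ("2_3" x y)
  then show ?case by (cases ys) auto
qed auto

lemma reduced_snoc: "reduced (xs @ [y, x]) \<longleftrightarrow> reduced (xs @ [y]) \<and> (xs \<noteq> [] \<longrightarrow> last xs \<noteq> x)"
  by (induction xs rule: reduced.induct) auto

lemma reduced_rev: "reduced (rev xs) \<longleftrightarrow> reduced xs"
proof (induction xs rule: reduced.induct)
  case (1 x y z zs)
  then show ?case using reduced_snoc[of "rev zs @ [z]" y x] by auto
qed auto

lemma reduced_appendD1: "reduced (xs @ ys) \<Longrightarrow> reduced xs"
  by (induction xs rule: reduced.induct) auto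

lemma reduced_appendD2: "reduced (xs @ ys) \<Longrightarrow> reduced ys"
  by (induction xs) (auto dest: reduced_ConsD)

lemma reduced_map: "inj_on f (set xs) \<Longrightarrow> reduced (map f xs) \<longleftrightarrow> reduced xs"
  by (induction xs rule: reduced.induct) (auto simp: inj_on_eq_iff)

lemma edge_path_Cons:
  "edge_path V E (x # xs) \<longleftrightarrow> x \<in> V \<and> (xs = [] \<or> {x, hd xs} \<in> E \<and> edge_path V E xs)"
  by (cases xs) (auto simp: edge_path_def)

lemma edge_path_glue:
  "edge_path V E (xs @ m # ys) \<longleftrightarrow> edge_path V E (xs @ [m]) \<and> edge_path V E (m # ys)"
  by (auto simp: edge_path_def successively_append_iff)

lemma edge_path_rev: "edge_path V E (rev xs) \<longleftrightarrow> edge_path V E xs"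
  by (simp add: edge_path_def successively_rev insert_commute)

section \<open>Existence and uniqueness of reduced paths in a tree\<close>

locale tree =
  fixes V :: "'v set" and E
  assumes simplicial_tree: "simplicial_tree V E"
begin

lemma edgeD: "{u, v} \<in> E \<Longrightarrow> u \<in> V \<and> v \<in> V \<and> u \<noteq> v"
  using simplicial_tree unfolding simplicial_tree_def simplicial_graph_def
  by (metis doubleton_eq_iff)

text \<open>If the first vertex \<open>x\<close> recurs, the stretch up to its first return is a
  circuit: its other vertices are distinct by induction, a stretch of one vertex would be a loop,
  and one of two vertices would be the backtracking \<open>x\<close>, \<open>y\<close>,
  \<open>x\<close>.\<close>

lemma reduced_imp_distinct:
  assumes "edge_path V E p" "reduced p"
  shows "distinct p"
  using assms
proof (induction p)
  case (Cons x p)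
  have "distinct p"
    using Cons by (cases "p = []") (auto simp: edge_path_Cons dest: reduced_ConsD)
  moreover have False if "x \<in> set p"
  proof -
    obtain ys zs where p: "p = ys @ x # zs" "x \<notin> set ys"
      using \<open>x \<in> set p\<close> by (meson split_list_first)
    have path: "edge_path V E ((x # ys) @ x # zs)" 
      using Cons.prems(1) unfolding p(1) by (simp only: append_Cons)
    have path1: "edge_path V E ((x # ys) @ [x])"
      using path edge_path_glue[of V E "x # ys" x zs] by (rule iffD1[THEN conjunct1, rotated])
    then have ed: "{last (x # ys), x} \<in> E"
      unfolding edge_path_def successively_append_iff by simp
    have "edge_path V E (x # ys)"
      using path1 unfolding edge_path_def successively_append_iff by simp
    moreover have "length (x # ys) \<ge> 3"
    proof (rule ccontr)
      assume "\<not> length (x # ys) \<ge> 3"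
      then consider "ys = []" | y where "ys = [y]"
        by (cases ys rule: reduced.cases) auto
      then show False
      proof cases
        case 1 then show False using edgeD[of x x] ed by simp
      next
        case 2 then show False using Cons.prems p by simp
      qed
    qed
    ultimately have "circuit V E (x # ys)"
      using ed p \<open>distinct p\<close> by (auto simp: circuit_def)
    then show False using simplicial_tree by (auto simp: simplicial_tree_def)
  qed
  ultimately show ?case by auto
qed simp

text \<open>If the paths separated right after \<open>x\<close>, then running back along one and out
  along the other would be a reduced path whose two ends coincide, against
  \<open>reduced_imp_distinct\<close>.\<close>

lemma reduced_path_unique:
  assumes "edge_path V E p" "reduced p" "edge_path V E q" "reduced q"
    and "hd p = hd q" "last p = last q"
  shows "p = q"
  using assms
proof (induction p arbitrary: q)
  case Nil
  then show ?case by (simp add: edge_path_def)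
next
  case (Cons x p)
  from Cons.prems obtain q' where q: "q = x # q'"
    by (cases q) (auto simp: edge_path_def)
  have dp: "distinct (x # p)" and dq: "distinct (x # q')"
    using Cons.prems q reduced_imp_distinct by blast+
  show ?case
  proof (cases "p = [] \<or> q' = []")
    case True
    then show ?thesis using Cons.prems q dp dq
      by (metis distinct.simps(2) last.simps last_in_set)
  next
    case False
    then have path: "edge_path V E p" "edge_path V E q'"
      using Cons.prems q by (auto simp: edge_path_Cons)
    have red: "reduced p" "reduced q'" using Cons.prems q by (auto dest: reduced_ConsD)
    have last: "last p = last q'" using Cons.prems q False by simp
    have "hd p = hd q'"
    proof (rule ccontr)
      assume ne: "hd p \<noteq> hd q'"
      have "reduced (rev p @ x # q')"
      proof (rule reduced_glue)
        show "reduced (rev p @ [x])" using Cons.prems reduced_rev[of "x # p"] by simp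
        show "reduced (x # q')" using Cons.prems q by simp
        show "last (rev p) \<noteq> hd q'" using ne False by (simp add: last_rev)
      qed
      moreover have "edge_path V E (rev p @ x # q')"
        using Cons.prems q edge_path_rev[of V E "x # p"] edge_path_glue[of V E "rev p" x q'] by simp
      ultimately have "distinct (rev p @ x # q')" by (rule reduced_imp_distinct[rotated])
      then show False using last False
        by (metis Un_iff disjoint_iff distinct_append last_in_set list.set_intros(2) set_rev)
    qed
    then show ?thesis using Cons.IH[OF path(1) red(1) path(2) red(2) _ last] q by simp
  qed
qed

text \<open>Backtracking is cancelled from the right end: a new first vertex \<open>x\<close> either
  extends the reduced path or equals its second vertex, and then dropping the head gives a path that
  starts at \<open>x\<close>.\<close>

lemma edge_path_imp_reduced:
  assumes "edge_path V E p"
  obtains q where "edge_path V E q" "reduced q" "hd q = hd p" "last q = last p"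
proof -
  have "\<exists>q. edge_path V E q \<and> reduced q \<and> hd q = hd p \<and> last q = last p"
    using assms
  proof (induction p)
    case (Cons x p)
    show ?case
    proof (cases "p = []")
      case True
      then show ?thesis using Cons by (intro exI[of _ "[x]"]) auto
    next
      case False
      then obtain q where q: "edge_path V E q" "reduced q" "hd q = hd p" "last q = last p"
        using Cons by (auto simp: edge_path_Cons)
      have xp: "x \<in> V" "{x, hd p} \<in> E" using Cons.prems False by (auto simp: edge_path_Cons)
      show ?thesis
      proof (cases "tl q \<noteq> [] \<and> hd (tl q) = x")
        case True
        then show ?thesis using q False
          by (intro exI[of _ "tl q"]; cases q) (auto simp: edge_path_Cons dest: reduced_ConsD)
      next
        case no: False
        have "reduced (x # q)" using no q by (cases q rule: reduced.cases) auto
        moreover have "edge_path V E (x # q)" using q xp by (auto simp: edge_path_Cons)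
        ultimately show ?thesis using q False
          by (intro exI[of _ "x # q"]) (auto simp: edge_path_def)
      qed
    qed
  qed (simp add: edge_path_def)
  then show thesis using that by blast
qed

lemma reduced_path_exists:
  assumes "u \<in> V" "v \<in> V"
  obtains p where "edge_path V E p" "reduced p" "hd p = u" "last p = v"
  using assms simplicial_tree edge_path_imp_reduced
  unfolding simplicial_tree_def graph_connected_def by metis

section \<open>Fixed vertices of tree automorphisms\<close>

definition tree_map :: "('v \<Rightarrow> 'v) \<Rightarrow> bool" where
  "tree_map g \<longleftrightarrow> inj_on g V \<and> g ` V \<subseteq> V \<and> (\<forall>u v. {u, v} \<in> E \<longrightarrow> {g u, g v} \<in> E)"

lemma tree_map_path:
  assumes "tree_map g" "edge_path V E p"
  shows "edge_path V E (map g p)"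
  using assms(2)
  by (induction p) (use assms(1) in \<open>auto simp: edge_path_Cons tree_map_def hd_map\<close>)

lemma tree_map_reduced:
  assumes "tree_map g" "edge_path V E p" "reduced p"
  shows "reduced (map g p)"
  using assms by (subst reduced_map) (auto simp: tree_map_def edge_path_def intro: inj_on_subset)

text \<open>\<open>m\<close> is the last entry before the lists separate; because the lengths agree,
  the two remainders are empty together.\<close>

lemma longest_common_prefix_split:
  assumes "length p = length q" "hd p = hd q" "p \<noteq> []"
  obtains w m xs ys where "p = w @ m # xs" "q = w @ m # ys" "length xs = length ys"
    "xs \<noteq> [] \<longrightarrow> hd xs \<noteq> hd ys"
proof -
  have "\<exists>w m xs ys. p = w @ m # xs \<and> q = w @ m # ys \<and> length xs = length ys \<and>
      (xs \<noteq> [] \<longrightarrow> hd xs \<noteq> hd ys)"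
    using assms
  proof (induction p q rule: list_induct2)
    case (Cons a p b q)
    show ?case
    proof (cases "p \<noteq> [] \<and> hd p = hd q")
      case True
      then obtain w m xs ys where "p = w @ m # xs \<and> q = w @ m # ys \<and> length xs = length ys \<and>
          (xs \<noteq> [] \<longrightarrow> hd xs \<noteq> hd ys)" using Cons by auto
      then show ?thesis using Cons.prems by (intro exI[of _ "a # w"]) auto
    next
      case False
      then show ?thesis using Cons by (intro exI[of _ "[]"]) auto
    qed
  qed simp
  then show thesis using that by blast
qed

text \<open>The reduced path from \<open>b\<close> to \<open>c\<close> and its image, from
  \<open>b\<close> to \<open>g c\<close>, run together up to \<open>m\<close> and then separate into
  tails of equal length. Back along one tail and out along the other is the reduced path from
  \<open>c\<close> to \<open>g c\<close>, with \<open>m\<close> in the middle. That middle depends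
  only on \<open>c\<close> and \<open>g c\<close>, so two maps that agree at \<open>c\<close> share
  it.\<close>

lemma tree_map_fixes_midpoint:
  assumes g: "tree_map g" and b: "b \<in> V" "g b = b" and c: "c \<in> V"
    and p: "edge_path V E p" "reduced p" "hd p = c" "last p = g c"
  shows "g (p ! (length p div 2)) = p ! (length p div 2)"
proof -
  obtain q where q: "edge_path V E q" "reduced q" "hd q = b" "last q = c"
    using reduced_path_exists[OF b(1) c] by blast
  have ne: "q \<noteq> []" using q by (simp add: edge_path_def)
  obtain w m xs ys where s: "q = w @ m # xs" "map g q = w @ m # ys" "length xs = length ys"
      "xs \<noteq> [] \<longrightarrow> hd xs \<noteq> hd ys"
    using longest_common_prefix_split[of q "map g q"] q b ne by (auto simp: hd_map)
  have gq: "edge_path V E (map g q)" "reduced (map g q)"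
    using tree_map_path tree_map_reduced g q by auto
  \<comment> \<open>\<open>m\<close> has the same index in \<open>q\<close> and in
    \<open>map g q\<close>, since both begin with \<open>w\<close>.\<close>
  have gm: "g m = m"
    using s(1,2) by (metis length_map append_eq_append_conv list.inject list.simps(9) map_append)
  have "reduced (rev xs @ m # ys)"
  proof (rule reduced_glue)
    have "reduced (m # xs)" using q(2) s(1) by (metis reduced_appendD2)
    then show "reduced (rev xs @ [m])" using reduced_rev[of "m # xs"] by simp
    show "reduced (m # ys)" using gq(2) s(2) by (metis reduced_appendD2)
    show "last (rev xs) \<noteq> hd ys" if "rev xs \<noteq> []" using s(4) that by (simp add: last_rev)
  qed
  moreover have "edge_path V E (rev xs @ m # ys)"
    using q(1) gq(1) s edge_path_rev[of V E "m # xs"] edge_path_glue by (metis rev.simps(2))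
  moreover have "hd (rev xs @ m # ys) = c"
    using q(4) s(1) by (cases xs) (auto simp: hd_append last_rev hd_rev)
  moreover have "last (rev xs @ m # ys) = g c"
    using q(4) s(2) ne by (metis last_appendR last_map list.discI)
  ultimately have "p = rev xs @ m # ys"
    using reduced_path_unique[OF p(1,2)] p(3,4) by metis
  \<comment> \<open>The length is \<open>2 * length xs + 1\<close>, so the middle index is
    \<open>length xs\<close>, the position of \<open>m\<close>.\<close>
  then have "p ! (length p div 2) = m"
    using s(3) by (simp add: nth_append)
  then show ?thesis using gm by simp
qed

text \<open>The intended \<open>s'\<close> is the inverse of \<open>s\<close>, with \<open>s (t c) = c\<close>.\<close>

lemma common_fixed_vertex:
  assumes s': "tree_map s'" "a \<in> V" "s' a = a" and t: "tree_map t" "b \<in> V" "t b = b"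
    and c: "c \<in> V" "s' c = t c"
  obtains m where "m \<in> V" "s' m = m" "t m = m"
proof -
  have "t c \<in> V" using t c by (auto simp: tree_map_def)
  \<comment> \<open>As \<open>s' c = t c\<close>, this one path serves for both maps, and its
    midpoint is fixed by both.\<close>
  then obtain p where p: "edge_path V E p" "reduced p" "hd p = c" "last p = t c"
    using reduced_path_exists[OF c(1)] by blast
  have "p \<noteq> []" "set p \<subseteq> V" using p by (auto simp: edge_path_def)
  then have "p ! (length p div 2) \<in> V" by (auto intro: nth_mem)
  then show thesis
    using that tree_map_fixes_midpoint[OF t c(1) p] tree_map_fixes_midpoint[OF s' c(1) p(1-3)] p(4) c(2)
    by metis
qed

text \<open>Take a shortest reduced path from a vertex \<open>c\<close> to its image. If it is not a
  single vertex, its translates under the powers of \<open>g\<close> fit together without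
  backtracking, so \<open>c\<close> moves along an axis and never returns, against
  \<open>g ^^ n\<close> being the identity.\<close>

lemma torsion_fixes_vertex:
  assumes g: "tree_map g" and n: "n > 0" "\<And>v. v \<in> V \<Longrightarrow> (g ^^ n) v = v"
    and noinv: "\<And>u v. {u, v} \<in> E \<Longrightarrow> g u = v \<Longrightarrow> g v = u \<Longrightarrow> False"
  obtains v where "v \<in> V" "g v = v"
proof -
  let ?P = "\<lambda>p. edge_path V E p \<and> reduced p \<and> g (hd p) = last p"
  obtain v where v: "v \<in> V" using simplicial_tree by (auto simp: simplicial_tree_def)
  then have "g v \<in> V" using g by (auto simp: tree_map_def)
  then have "\<exists>p. ?P p" using reduced_path_exists[OF v] by metis
  then obtain p where p: "?P p" and min: "\<And>q. ?P q \<Longrightarrow> length p \<le> length q"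
    using ex_has_least_nat[of ?P _ length] by metis
  obtain c p' where pc: "p = c # p'" using p by (cases p) (auto simp: edge_path_def)
  have cV: "c \<in> V" using p pc by (simp add: edge_path_Cons)
  show thesis
  proof (cases "p' = []")
    case True
    then have "g c = c" using p pc by simp
    then show thesis by (rule that[OF cV])
  next
    case False
    define d where "d = hd p'"
    define e where "e = last (butlast p)"
    have pl: "p = butlast p @ [g c]" "butlast p \<noteq> []" "hd (butlast p) = c"
      using p pc False by (auto simp: append_butlast_last_id neq_Nil_conv)
    have path: "edge_path V E p" "reduced p" using p by auto
    \<comment> \<open>Otherwise removing both ends of \<open>p\<close> leaves a shorter path from
      \<open>d\<close> to \<open>g d\<close>. The two short cases are separate: if \<open>p\<close>
      is one edge, then \<open>g\<close> inverts it; if it has two edges, then \<open>d\<close> is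
      fixed.\<close>
    have "e \<noteq> g d"
    proof
      assume ed: "e = g d"
      obtain p'' where p': "p' = d # p''" using False by (cases p') (auto simp: d_def)
      show False
      proof (cases "length p'' \<le> 1")
        case True
        then consider "p'' = []" | "p'' = [g c]"
          using p pc p' by (cases p'') auto
        then show False
        proof cases
          case 1
          then have "{c, d} \<in> E" "g c = d" "g d = c"
            using p pc p' ed by (auto simp: edge_path_Cons e_def)
          then show False using noinv by blast
        next
          case 2
          then have "g d = d" using ed pc p' by (simp add: e_def)
          moreover have "d \<in> V" using path pc p' by (simp add: edge_path_Cons)
          ultimately show False using min[of "[d]"] pc p' by (simp add: edge_path_Cons)
        qed
      next
        case long: False
        let ?q = "butlast p'"
        have q: "p' = ?q @ [g c]" "?q \<noteq> []"
          using p pc p' long by (cases p''; simp)+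
        have "edge_path V E p'" "reduced p'"
          using path pc False by (auto simp: edge_path_Cons dest: reduced_ConsD)
        then have "edge_path V E ?q" "reduced ?q"
          using q by (metis edge_path_def set_append le_sup_iff successively_append_iff)
            (metis q(1) reduced_appendD1 \<open>reduced p'\<close>)
        moreover have "hd ?q = d" using q by (metis d_def hd_append2)
        moreover have "last ?q = g d" using ed q pc False by (simp add: e_def)
        ultimately show False using min[of ?q] pc by fastforce
      qed
    qed
    \<comment> \<open>The invariant records the first two vertices: after applying \<open>g\<close>,
      the second one becomes \<open>g d\<close>, and the join at \<open>g c\<close> is reduced
      because \<open>e\<close> differs from it. Prepending \<open>butlast p\<close> restores the
      beginning \<open>c\<close>, \<open>d\<close>.\<close>
    have "\<exists>q. edge_path V E (c # d # q) \<and> reduced (c # d # q) \<and> last (c # d # q) = (g ^^ Suc j) c" for j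
    proof (induction j)
      case 0
      show ?case using path pc p False by (intro exI[of _ "tl p'"]) (auto simp: d_def)
    next
      case (Suc j)
      then obtain q where q: "edge_path V E (c # d # q)" "reduced (c # d # q)"
          "last (c # d # q) = (g ^^ Suc j) c" by blast
      have gq: "edge_path V E (map g (c # d # q))" "reduced (map g (c # d # q))"
        using tree_map_path[OF g q(1)] tree_map_reduced[OF g q(1,2)] by auto
      have "reduced (butlast p @ g c # map g (d # q))"
      proof (rule reduced_glue)
        show "reduced (butlast p @ [g c])" using path pl by metis
        show "reduced (g c # map g (d # q))" using gq by simp
        show "last (butlast p) \<noteq> hd (map g (d # q))" using \<open>e \<noteq> g d\<close> by (simp add: e_def)
      qed
      moreover have "edge_path V E (butlast p @ g c # map g (d # q))"
        using gq path pl edge_path_glue by (metis list.simps(9))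
      moreover have "last (butlast p @ g c # map g (d # q)) = (g ^^ Suc (Suc j)) c"
        using q(3) by (auto simp: last_map split: if_splits)
      moreover have "\<exists>q'. butlast p @ g c # map g (d # q) = c # d # q'"
      proof (cases "tl p' = []")
        case True
        then have "p' = [d]" using False by (cases p') (auto simp: d_def)
        then show ?thesis using p pc by simp
      next
        case no: False
        then show ?thesis using pc by (cases p'; cases "tl p'") (auto simp: d_def)
      qed
      ultimately show ?case by metis
    qed
    from this[of "n - 1"] obtain q where q: "edge_path V E (c # d # q)" "reduced (c # d # q)"
        "last (c # d # q) = c" using n cV by auto
    have "distinct (c # d # q)" using reduced_imp_distinct q by blast
    then show thesis using q(3) by (metis distinct.simps(2) last_ConsR last_in_set list.discI)
  qed
qed

end

section \<open>Groups generated by two torsion elements\<close>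

lemma (in group_action) funpow_action:
  assumes "g \<in> carrier G" "x \<in> E"
  shows "(\<phi> g ^^ n) x = \<phi> (g [^]\<^bsub>G\<^esub> n) x"
proof -
  interpret group_hom G "BijGroup E" \<phi> by (rule group_hom)
  show ?thesis
  proof (induction n)
    case 0
    have "\<phi> \<one> x = x" using id_eq_one assms(2) by (metis restrict_apply')
    then show ?case by simp
  next
    case (Suc n)
    have "\<phi> (g [^]\<^bsub>G\<^esub> Suc n) x = \<phi> (g \<otimes> (g [^]\<^bsub>G\<^esub> n)) x"
      using assms(1) by (metis G.nat_pow_Suc2)
    also have "\<dots> = \<phi> g (\<phi> (g [^]\<^bsub>G\<^esub> n) x)"
      using assms by (intro composition_rule) auto
    finally show ?case using Suc by simp
  qed
qed

text \<open>A vertex \<open>c\<close> fixed by the product is sent to the same vertex by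
  \<open>t\<close> and by the inverse of \<open>s\<close>, so \<open>common_fixed_vertex\<close>
  applies. The stabilizer of the vertex obtained contains both generators.\<close>

lemma property_FA_two_generators:
  fixes G (structure)
  assumes "group G" and st: "s \<in> carrier G" "t \<in> carrier G"
    and gen: "generate G {s, t} = carrier G"
    and tors: "s [^] i = \<one>" "i > (0::nat)" "t [^] j = \<one>" "j > (0::nat)"
      "(s \<otimes> t) [^] k = \<one>" "k > (0::nat)"
  shows "property_FA TYPE('v) G"
  unfolding property_FA_def
proof (intro allI impI)
  fix V :: "'v set" and E \<phi>
  assume *: "simplicial_tree V E \<and> simplicial_action G V E \<phi> \<and> without_inversions G E \<phi>"
  interpret tree V E using * by unfold_locales simp
  interpret group_action G V \<phi> using * by (simp add: simplicial_action_def)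
  interpret group G by fact
  have map: "tree_map (\<phi> g)" if "g \<in> carrier G" for g
    unfolding tree_map_def
  proof (intro conjI allI impI)
    show "inj_on (\<phi> g) V" "\<phi> g ` V \<subseteq> V"
      using that inj_prop surj_prop by auto
    show "{\<phi> g u, \<phi> g v} \<in> E" if "{u, v} \<in> E" for u v
    proof -
      have "\<phi> g ` {u, v} \<in> E"
        using * that \<open>g \<in> carrier G\<close> unfolding simplicial_action_def by blast
      then show ?thesis by simp
    qed
  qed
  have one: "\<phi> \<one> v = v" if "v \<in> V" for v
    using id_eq_one that by (metis restrict_apply')
  have ell: "\<exists>v \<in> V. \<phi> g v = v" if g: "g \<in> carrier G" and n: "g [^] n = \<one>" "n > (0::nat)" for g n
  proof -
    have "(\<phi> g ^^ n) v = v" if "v \<in> V" for v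
      using funpow_action[OF g that, of n] n one[OF that] by simp
    moreover have False if "{u, v} \<in> E" "\<phi> g u = v" "\<phi> g v = u" for u v
    proof -
      have "\<phi> g ` {u, v} = {u, v}" using that by auto
      then have "\<phi> g u = u" using * g that(1) unfolding without_inversions_def by blast
      then show False using that edgeD by metis
    qed
    ultimately show ?thesis using torsion_fixes_vertex[OF map[OF g] n(2)] by metis
  qed
  obtain a where a: "a \<in> V" "\<phi> s a = a" using ell[OF st(1) tors(1,2)] by blast
  obtain b where b: "b \<in> V" "\<phi> t b = b" using ell[OF st(2) tors(3,4)] by blast
  obtain c where c: "c \<in> V" "\<phi> (s \<otimes> t) c = c"
    using ell[OF m_closed[OF st] tors(5,6)] by blast
  have sa: "\<phi> (inv s) a = a" using orbit_sym_aux[OF st(1) a] by simp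
  have "\<phi> t c \<in> V" using element_image[OF st(2) c(1)] by simp
  moreover have "\<phi> s (\<phi> t c) = c" using composition_rule[OF c(1) st] c(2) by simp
  ultimately have sc: "\<phi> (inv s) c = \<phi> t c" using orbit_sym_aux[OF st(1)] by metis
  obtain m where m: "m \<in> V" "\<phi> (inv s) m = m" "\<phi> t m = m"
    using common_fixed_vertex[OF map[OF inv_closed[OF st(1)]] a(1) sa map[OF st(2)] b c(1) sc]
    by blast
  have "\<phi> s m = m" using orbit_sym_aux[OF inv_closed[OF st(1)] m(1,2)] st by simp
  then have "{s, t} \<subseteq> stabilizer G \<phi> m" using m st by (auto simp: stabilizer_def)
  then have "generate G {s, t} \<subseteq> stabilizer G \<phi> m"
    using generate_subgroup_incl stabilizer_subgroup[OF m(1)] by blast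
  then show "\<exists>v\<in>V. \<forall>g\<in>carrier G. \<phi> g v = v"
    using gen m(1) by (auto simp: stabilizer_def)
qed

section \<open>Splitting a leaf\<close>

text \<open>Lifts of the map \<open>\<real>/n\<int> \<rightarrow> \<real>/(n + 1)\<int>\<close> that stretches \<open>[0, 1]\<close> to \<open>[0, 2]\<close> and translates the
  other unit intervals, and of its inverse.\<close>

definition split_leaf :: "nat \<Rightarrow> real \<Rightarrow> real" where
  "split_leaf n x = x + of_int \<lfloor>x / n\<rfloor> + min 1 (x - real n * of_int \<lfloor>x / n\<rfloor>)"

definition merge_leaf :: "nat \<Rightarrow> real \<Rightarrow> real" where
  "merge_leaf n y = real n * of_int \<lfloor>y / real (Suc n)\<rfloor> +
     max ((y - real (Suc n) * of_int \<lfloor>y / real (Suc n)\<rfloor>) / 2)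
       (y - real (Suc n) * of_int \<lfloor>y / real (Suc n)\<rfloor> - 1)"

lemma reduce_mod:
  fixes x :: real
  assumes "n > (0::nat)"
  obtains k :: int and y :: real where "x = y + real n * of_int k" "0 \<le> y" "y < n"
proof -
  let ?k = "\<lfloor>x / n\<rfloor>"
  have "0 \<le> x - real n * of_int ?k" "x - real n * of_int ?k < n"
    using assms floor_divide_lower[of "real n" x] floor_divide_upper[of "real n" x]
    by (simp_all add: algebra_simps)
  then show thesis by (intro that[of "x - real n * of_int ?k" ?k]) simp_all
qed

lemma split_leaf_shift:
  assumes "n > 0"
  shows "split_leaf n (x + real n * of_int k) = split_leaf n x + real (Suc n) * of_int k"
proof -
  have "(x + real n * of_int k) / n = x / n + of_int k" using assms by (simp add: field_simps)
  then have "\<lfloor>(x + real n * of_int k) / n\<rfloor> = \<lfloor>x / n\<rfloor> + k" by simp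
  then show ?thesis unfolding split_leaf_def by (simp add: algebra_simps)
qed

lemma merge_leaf_shift: "merge_leaf n (y + real (Suc n) * of_int k) = merge_leaf n y + real n * of_int k"
proof -
  have "(y + real (Suc n) * of_int k) / Suc n = y / Suc n + of_int k"
    by (simp add: add_divide_distrib)
  then have *: "\<lfloor>(y + real (Suc n) * of_int k) / Suc n\<rfloor> = \<lfloor>y / Suc n\<rfloor> + k" by simp
  show ?thesis unfolding merge_leaf_def * by (simp add: algebra_simps)
qed

text \<open>The right end \<open>x = n\<close> is included although the floor jumps there: both
  formulas give \<open>n + 1\<close>. This spares boundary cases in the piecewise
  computations.\<close>

lemma split_leaf_base:
  fixes x :: real
  assumes "n > 0" "0 \<le> x" "x \<le> n"
  shows "split_leaf n x = x + min 1 x"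
proof (cases "x = n")
  case True
  then show ?thesis using assms by (simp add: split_leaf_def)
next
  case False
  then have "\<lfloor>x / n\<rfloor> = 0" using assms by (intro floor_unique) (auto simp: field_simps)
  then show ?thesis by (simp add: split_leaf_def)
qed

lemma merge_leaf_base:
  fixes y :: real
  assumes "n > 0" "0 \<le> y" "y \<le> Suc n"
  shows "merge_leaf n y = max (y / 2) (y - 1)"
proof (cases "y = Suc n")
  case True
  then have "y / Suc n = 1" by simp
  then have "\<lfloor>y / Suc n\<rfloor> = 1" by simp
  then have "merge_leaf n y = n" using True by (simp add: merge_leaf_def)
  then show ?thesis using True assms by (simp add: max_def)
next
  case False
  then have "\<lfloor>y / Suc n\<rfloor> = 0" using assms by (intro floor_unique) (auto simp: field_simps)
  then show ?thesis by (simp add: merge_leaf_def)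
qed

lemma merge_leaf_split:
  assumes "n > 0"
  shows "merge_leaf n (split_leaf n x) = x"
proof -
  obtain k :: int and y :: real where x: "x = y + real n * of_int k" "0 \<le> y" "y < n" using reduce_mod[OF assms] .
  have "merge_leaf n (split_leaf n y) = y"
    using x assms by (auto simp: split_leaf_base merge_leaf_base min_def max_def)
  then show ?thesis unfolding x(1) split_leaf_shift[OF assms] merge_leaf_shift by simp
qed

lemma split_leaf_merge:
  assumes "n > 0"
  shows "split_leaf n (merge_leaf n x) = x"
proof -
  obtain k :: int and y :: real where x: "x = y + real (Suc n) * of_int k" "0 \<le> y" "y < Suc n"
    using reduce_mod[of "Suc n"] by blast
  have "split_leaf n (merge_leaf n y) = y"
    using x assms by (auto simp: split_leaf_base merge_leaf_base min_def max_def)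
  then show ?thesis unfolding x(1) merge_leaf_shift split_leaf_shift[OF assms] by simp
qed

text \<open>Conjugating by the translation by \<open>j\<close> turns the splitting of leaf \<open>0\<close> into that of leaf \<open>j\<close>:
  both sides split the leaves \<open>0\<close> and \<open>j\<close>, in either order.\<close>

lemma split_leaf_commute:
  fixes x :: real
  assumes "0 < j" "j < n"
  shows "split_leaf (Suc n) (split_leaf n x - Suc j) + Suc j = split_leaf (Suc n) (split_leaf n (x - j) + j)"
proof -
  have n: "n > 0" using assms by simp
  obtain k :: int and y :: real where x: "x = y + real n * of_int k" "0 \<le> y" "y < n" using reduce_mod[OF n] .
  \<comment> \<open>Arguments that a translation has made negative are raised by one full period,
    into the range of \<open>split_leaf_base\<close>.\<close>
  have up: "split_leaf (Suc n) z = split_leaf (Suc n) (z + Suc n) - Suc (Suc n)" for z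
    using split_leaf_shift[of "Suc n" z 1] by simp
  have up': "split_leaf n z = split_leaf n (z + n) - Suc n" for z
    using split_leaf_shift[of n z 1] n by simp
  have "split_leaf (Suc n) (split_leaf n y - Suc j) + Suc j = split_leaf (Suc n) (split_leaf n (y - j) + j)"
  \<comment> \<open>The cases are: \<open>y\<close> in leaf \<open>0\<close>; at or beyond the start
    of leaf \<open>j\<close>; in between.\<close>
  proof (cases "y \<le> 1")
    case True
    have "split_leaf (Suc n) (split_leaf n y - Suc j) = 2 * y - Suc j"
      using True x assms by (subst up) (auto simp: split_leaf_base)
    moreover have "split_leaf n (y - j) = y - j"
      using True x assms by (subst up') (auto simp: split_leaf_base)
    ultimately show ?thesis using True x assms by (simp add: split_leaf_base)
  next
    case y1: False
    then have sy: "split_leaf n y = y + 1" using x n by (simp add: split_leaf_base)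
    show ?thesis
    proof (cases "j \<le> y")
      case True
      then show ?thesis using y1 x assms sy by (simp add: split_leaf_base)
    next
      case False
      have "split_leaf (Suc n) (split_leaf n y - Suc j) = y - j"
        using y1 sy False x assms by (subst up) (auto simp: split_leaf_base)
      moreover have "split_leaf n (y - j) = y - j"
        using y1 False x assms by (subst up') (auto simp: split_leaf_base)
      ultimately show ?thesis using y1 x assms by (simp add: split_leaf_base)
    qed
  qed
  moreover have "split_leaf n (y + real n * of_int k - j) = split_leaf n (y - j) + real (Suc n) * of_int k"
    using split_leaf_shift[OF n, of "y - j" k] by (simp add: algebra_simps)
  moreover have "split_leaf (Suc n) (split_leaf n y + real (Suc n) * of_int k - Suc j) =
      split_leaf (Suc n) (split_leaf n y - Suc j) + real (Suc (Suc n)) * of_int k"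
    using split_leaf_shift[of "Suc n" "split_leaf n y - Suc j" k] by (simp add: algebra_simps)
  moreover have "split_leaf (Suc n) (split_leaf n (y - j) + real (Suc n) * of_int k + j) =
      split_leaf (Suc n) (split_leaf n (y - j) + j) + real (Suc (Suc n)) * of_int k"
    using split_leaf_shift[of "Suc n" "split_leaf n (y - j) + j" k] by (simp add: algebra_simps)
  ultimately show ?thesis unfolding x(1) split_leaf_shift[OF n] by simp
qed

lemma split_leaf_1: "split_leaf 1 x = 2 * x"
  by (simp add: split_leaf_def min_def) linarith

text \<open>Both leaves of R/2Z get split: after the first splitting the other leaf is [2, 3], and
  the rotation takes it to [3, 4], which is leaf \<open>0\<close> modulo 3. Splitting every leaf is
  doubling, up to a translation.\<close>

lemma split_leaf_split_double: "split_leaf 3 (split_leaf 2 x + 1) = 2 * x + 2"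
proof -
  obtain k :: int and y :: real where x: "x = y + 2 * of_int k" "0 \<le> y" "y < 2" by (rule reduce_mod[of 2 x]) auto
  have "split_leaf 3 (split_leaf 2 y + 1) = 2 * y + 2"
  proof (cases "y \<le> 1")
    case True
    then show ?thesis using x by (simp add: split_leaf_base)
  next
    case False
    have "split_leaf 3 (split_leaf 2 y + 1) = split_leaf 3 (y - 1 + 3)" using x False by (simp add: split_leaf_base)
    also have "\<dots> = split_leaf 3 (y - 1) + 4" using split_leaf_shift[of 3 "y - 1" 1] by simp
    also have "\<dots> = 2 * y + 2" using x False by (simp add: split_leaf_base)
    finally show ?thesis .
  qed
  then show ?thesis
    using split_leaf_shift[of 2 y k] split_leaf_shift[of 3 "split_leaf 2 y + 1" k] unfolding x(1)
    by (simp add: algebra_simps)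
qed

section \<open>Leaf coordinates on R/Z and the rotations of three, four and five leaves\<close>

text \<open>\<open>vine n\<close> identifies \<open>\<real>/\<int>\<close> with \<open>\<real>/n\<int>\<close> by mapping the intervals
  \<open>[0, 2\<^sup>1\<^sup>-\<^sup>n], [2\<^sup>1\<^sup>-\<^sup>n, 2\<^sup>2\<^sup>-\<^sup>n], \<dots>, [1/2, 1]\<close> to the \<open>n\<close> unit intervals.\<close>

fun vine :: "nat \<Rightarrow> real \<Rightarrow> real" where
  "vine (Suc (Suc n)) x = split_leaf (Suc n) (vine (Suc n) x)"
| "vine _ x = x"

lemma vine_shift: "n > 0 \<Longrightarrow> vine n (x + of_int k) = vine n x + real n * of_int k"
proof (induction n rule: nat_induct_non_zero)
  case (Suc n)
  then show ?case by (cases n) (simp_all add: split_leaf_shift del: of_nat_Suc)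
qed simp

lemma inj_vine: "inj (vine n)"
proof (induction n rule: induct_nat_012)
  case (ge2 n)
  then show ?case
    by (metis (mono_tags, lifting) injD injI merge_leaf_split vine.simps(1) zero_less_Suc)
qed (auto simp: inj_def)

text \<open>The rotations of the three leaves of \<^term>\<open>vine 3\<close> and the four leaves of \<^term>\<open>vine 4\<close>.\<close>

definition beta_lift :: "real \<Rightarrow> real" where
  "beta_lift x = of_int \<lfloor>x\<rfloor> +
     (if frac x \<le> 1/4 then frac x + 1/4
      else if frac x \<le> 1/2 then 2 * frac x else frac x / 2 + 3/4)"

definition alpha_lift :: "real \<Rightarrow> real" where
  "alpha_lift x = of_int \<lfloor>x\<rfloor> +
     (if frac x \<le> 1/8 then frac x + 1/8
      else if frac x \<le> 1/2 then 2 * frac x else frac x / 4 + 7/8)"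

lemma beta_lift_shift: "beta_lift (x + of_int k) = beta_lift x + of_int k"
  by (simp add: beta_lift_def frac_add_int_right)

lemma alpha_lift_shift: "alpha_lift (x + of_int k) = alpha_lift x + of_int k"
  by (simp add: alpha_lift_def frac_add_int_right)

lemma beta_lift_base:
  assumes "0 \<le> x" "x \<le> 1"
  shows "beta_lift x = (if x \<le> 1/4 then x + 1/4 else if x \<le> 1/2 then 2 * x else x / 2 + 3/4)"
proof (cases "x = 1")
  case False
  then have "frac x = x" "\<lfloor>x\<rfloor> = 0" using assms by (auto simp: frac_eq floor_unique)
  then show ?thesis by (simp add: beta_lift_def)
qed (simp add: beta_lift_def)

lemma alpha_lift_base:
  assumes "0 \<le> x" "x \<le> 1"
  shows "alpha_lift x = (if x \<le> 1/8 then x + 1/8 else if x \<le> 1/2 then 2 * x else x / 4 + 7/8)"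
proof (cases "x = 1")
  case False
  then have "frac x = x" "\<lfloor>x\<rfloor> = 0" using assms by (auto simp: frac_eq floor_unique)
  then show ?thesis by (simp add: alpha_lift_def)
qed (simp add: alpha_lift_def)

lemma vine_3_base: "0 \<le> x \<Longrightarrow> x \<le> 1 \<Longrightarrow> vine 3 x = (if x \<le> 1/2 then 4 * x else 2 * x + 1)"
  using split_leaf_base[of 2 "2 * x"] by (simp add: eval_nat_numeral split_leaf_1[simplified] min_def)

lemma vine_4_base:
  "0 \<le> x \<Longrightarrow> x \<le> 1 \<Longrightarrow>
   vine 4 x = (if x \<le> 1/4 then 8 * x else if x \<le> 1/2 then 4 * x + 1 else 2 * x + 2)"
proof -
  assume x: "0 \<le> x" "x \<le> 1"
  have "vine 4 x = split_leaf 3 (vine 3 x)" by (simp add: eval_nat_numeral)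
  then show ?thesis using x vine_3_base[OF x] by (auto simp: split_leaf_base)
qed

lemma vine_up: "n > 0 \<Longrightarrow> vine n x = vine n (x - 1) + n"
  using vine_shift[of n "x - 1" 1] by simp

lemma unit_interval_reduce:
  obtains k :: int and y :: real where "x = y + of_int k" "0 \<le> y" "y \<le> 1"
  by (rule that[of "frac x" "\<lfloor>x\<rfloor>"]) (use frac_lt_1[of x] in \<open>auto simp: frac_def\<close>)

lemma vine_beta: "vine 3 (beta_lift x) = vine 3 x + 1"
proof -
  obtain k :: int and y where x: "x = y + of_int k" "0 \<le> y" "y \<le> 1"
    by (rule unit_interval_reduce)
  have "vine 3 (beta_lift y) = vine 3 y + 1"
  proof (cases "y \<le> 1/2")
    case True
    then show ?thesis using x by (auto simp: beta_lift_base vine_3_base)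
  next
    case False
    \<comment> \<open>The image \<open>y / 2 + 3/4\<close> has passed 1, so it is moved back by a
      full turn before \<open>vine_3_base\<close> applies.\<close>
    then have "vine 3 (beta_lift y) = vine 3 (y / 2 - 1/4) + 3"
      using x by (simp add: beta_lift_base vine_up[of 3 "y / 2 + 3/4"])
    then show ?thesis using x False by (simp add: vine_3_base)
  qed
  then show ?thesis unfolding x(1) by (simp add: beta_lift_shift vine_shift)
qed

lemma vine_alpha: "vine 4 (alpha_lift x) = vine 4 x + 1"
proof -
  obtain k :: int and y where x: "x = y + of_int k" "0 \<le> y" "y \<le> 1"
    by (rule unit_interval_reduce)
  have "vine 4 (alpha_lift y) = vine 4 y + 1"
  proof (cases "y \<le> 1/2")
    case True
    then show ?thesis using x by (auto simp: alpha_lift_base vine_4_base)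
  next
    case False
    then have "vine 4 (alpha_lift y) = vine 4 (y / 4 - 1/8) + 4"
      using x by (simp add: alpha_lift_base vine_up[of 4 "y / 4 + 7/8"])
    then show ?thesis using x False by (simp add: vine_4_base)
  qed
  then show ?thesis unfolding x(1) by (simp add: alpha_lift_shift vine_shift)
qed

text \<open>The leaves \<open>[0, 1/8]\<close>, \<open>[1/8, 1/4]\<close>, \<open>[1/4, 3/8]\<close>, \<open>[3/8, 1/2]\<close>, \<open>[1/2, 1]\<close> form the
  pentagon that the product of the rotations of a triangle and a quadrilateral rotates.\<close>

definition pentagon :: "real \<Rightarrow> real" where
  "pentagon x = split_leaf 4 (vine 4 x - 2) + 2"

lemma pentagon_shift: "pentagon (x + of_int k) = pentagon x + 5 * of_int k"
  using vine_shift[of 4 x k] split_leaf_shift[of 4 "vine 4 x - 2" k]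
  by (simp add: pentagon_def algebra_simps)

lemma inj_pentagon: "inj pentagon"
proof (rule injI)
  fix x y assume "pentagon x = pentagon y"
  then have "vine 4 x - 2 = vine 4 y - 2"
    unfolding pentagon_def by (metis add_right_cancel merge_leaf_split zero_less_numeral)
  then show "x = y" using inj_vine by (simp add: inj_eq)
qed

lemma pentagon_base:
  assumes "0 \<le> x" "x \<le> 1"
  shows "pentagon x = (if x \<le> 1/2 then 8 * x else 2 * x + 3)"
proof (cases "x \<le> 1/4")
  case True
  have "split_leaf 4 (vine 4 x - 2) = split_leaf 4 (vine 4 x + 2) - 5"
    using split_leaf_shift[of 4 "vine 4 x - 2" 1] by (simp add: add.commute)
  then show ?thesis using True assms by (simp add: pentagon_def vine_4_base split_leaf_base)
next
  case False
  then show ?thesis using assms by (auto simp: pentagon_def vine_4_base split_leaf_base)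
qed

lemma pentagon_beta_alpha: "pentagon (beta_lift (alpha_lift x)) = pentagon x + 3"
proof -
  obtain k :: int and y where x: "x = y + of_int k" "0 \<le> y" "y \<le> 1"
    by (rule unit_interval_reduce)
  have up: "pentagon z = pentagon (z - 1) + 5" for z using pentagon_shift[of "z - 1" 1] by simp
  have "pentagon (beta_lift (alpha_lift y)) = pentagon y + 3"
  proof (cases "y \<le> 1/4")
    case True
    then show ?thesis using x by (auto simp: alpha_lift_base beta_lift_base pentagon_base)
  next
    case y4: False
    show ?thesis
    proof (cases "y \<le> 1/2")
      case True
      then have "beta_lift (alpha_lift y) = y + 3/4"
        using y4 x by (auto simp: alpha_lift_base beta_lift_base)
      then show ?thesis using True y4 x by (simp add: up[of "y + 3/4"] pentagon_base)
    next
      case False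
      \<comment> \<open>\<open>alpha_lift y\<close> lies beyond 1; the full turn is split off so
        that \<open>beta_lift_base\<close> applies to the rest.\<close>
      have "alpha_lift y = (y / 4 - 1/8) + of_int 1" using False x by (simp add: alpha_lift_base)
      then have "beta_lift (alpha_lift y) = beta_lift (y / 4 - 1/8) + 1"
        by (metis beta_lift_shift of_int_1)
      then have "beta_lift (alpha_lift y) = y / 4 + 1/8 + 1"
        using False x by (simp add: beta_lift_base)
      then have "pentagon (beta_lift (alpha_lift y)) = pentagon (y / 4 + 1/8) + 5"
        using up[of "y / 4 + 1/8 + 1"] by (simp add: add.commute)
      then show ?thesis using False x by (simp add: pentagon_base)
    qed
  qed
  then show ?thesis unfolding x(1) by (simp add: alpha_lift_shift beta_lift_shift pentagon_shift)
qed

text \<open>In the coordinate \<open>p\<close> on R/nZ the map rotates by \<open>k\<close> leaves,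
  so \<open>n\<close> iterations make \<open>k\<close> full turns, which is trivial on the
  circle.\<close>

lemma conj_translation_power:
  fixes p :: "real \<Rightarrow> real" and k :: int
  assumes "inj p" "\<And>x. p (F x) = p x + of_int k"
    "\<And>x k. p (x + of_int k) = p x + real n * of_int k"
  shows "(F ^^ n) x = x + of_int k"
proof -
  have "p ((F ^^ m) x) = p x + real m * of_int k" for m
    by (induction m) (simp_all add: assms(2) algebra_simps)
  then have "p ((F ^^ n) x) = p (x + of_int k)" by (simp add: assms(3))
  then show ?thesis using assms(1) by (simp add: inj_eq)
qed

lemma beta_lift_power: "(beta_lift ^^ 3) x = x + 1"
  using conj_translation_power[OF inj_vine[of 3], of beta_lift 1 3] by (simp add: vine_beta vine_shift)

lemma alpha_lift_power: "(alpha_lift ^^ 4) x = x + 1"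
  using conj_translation_power[OF inj_vine[of 4], of alpha_lift 1 4] by (simp add: vine_alpha vine_shift)

lemma beta_alpha_lift_power: "((beta_lift \<circ> alpha_lift) ^^ 5) x = x + 3"
  using conj_translation_power[OF inj_pentagon, of "beta_lift \<circ> alpha_lift" 3 5]
  by (simp add: pentagon_beta_alpha pentagon_shift)

section \<open>Subdivisions and the groupoid of splittings\<close>

text \<open>These are the maps that only split leaves. The exponents are natural numbers, so no leaf
  shrinks; hence \<open>n\<close> is at most \<open>m\<close>, and \<open>m - n\<close> counts the
  splittings.\<close>

definition subdivision :: "nat \<Rightarrow> nat \<Rightarrow> (real \<Rightarrow> real) \<Rightarrow> bool" where
  "subdivision n m \<Psi> \<longleftrightarrow> (\<forall>x. \<Psi> (x + real n) = \<Psi> x + real m) \<and>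
     (\<forall>i::int. \<Psi> (of_int i) \<in> \<int> \<and>
       (\<exists>e::nat. \<forall>u\<in>{0..1}. \<Psi> (of_int i + u) = \<Psi> (of_int i) + 2 ^ e * u))"

lemma periodic_shift_int:
  fixes F :: "real \<Rightarrow> real"
  assumes "\<And>x. F (x + a) = F x + b"
  shows "F (x + a * of_int k) = F x + b * of_int k"
proof (induction k rule: int_induct[where k = 0])
  case (step1 i)
  then show ?case using assms[of "x + a * of_int i"] by (simp add: algebra_simps)
next
  case (step2 i)
  then show ?case using assms[of "x + a * of_int (i - 1)"] by (simp add: algebra_simps)
qed simp

lemma subdivisionI:
  fixes \<Psi> :: "real \<Rightarrow> real"
  assumes n: "n > 0" and per: "\<And>x. \<Psi> (x + real n) = \<Psi> x + real m"
    and piece: "\<And>i. i < n \<Longrightarrow> \<Psi> (real i) \<in> \<int> \<and>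
      (\<exists>e::nat. \<forall>u\<in>{0..1}. \<Psi> (real i + u) = \<Psi> (real i) + 2 ^ e * u)"
  shows "subdivision n m \<Psi>"
  unfolding subdivision_def
proof (intro conjI allI)
  fix j :: int
  define i where "i = nat (j mod int n)"
  define k where "k = j div int n"
  have "j = int i + int n * k" "i < n"
    using n by (simp_all add: i_def k_def nat_less_iff)
  then have *: "\<Psi> (of_int j + u) = \<Psi> (real i + u) + real m * of_int k" for u
    using periodic_shift_int[of \<Psi>, OF per, of "real i + u" k] by (simp add: algebra_simps)
  from *[of 0] piece[OF \<open>i < n\<close>] show "\<Psi> (of_int j) \<in> \<int>" by simp
  from piece[OF \<open>i < n\<close>] obtain e :: nat
    where "\<forall>u\<in>{0..1}. \<Psi> (real i + u) = \<Psi> (real i) + 2 ^ e * u" by blast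
  then have "\<forall>u\<in>{0..1}. \<Psi> (of_int j + u) = \<Psi> (of_int j) + 2 ^ e * u"
    using * *[of 0] by simp
  then show "\<exists>e::nat. \<forall>u\<in>{0..1}. \<Psi> (of_int j + u) = \<Psi> (of_int j) + 2 ^ e * u" ..
qed (rule per)

lemma subdivision_translate:
  assumes "subdivision n m \<Psi>"
  shows "subdivision n m (\<lambda>x. \<Psi> (x + of_int k))"
  unfolding subdivision_def
proof (intro conjI allI)
  show "\<Psi> (x + real n + of_int k) = \<Psi> (x + of_int k) + real m" for x
    using assms unfolding subdivision_def by (metis add.assoc add.commute)
  show "\<Psi> (of_int i + of_int k) \<in> \<int>" for i
    using assms unfolding subdivision_def by (metis of_int_add)
  show "\<exists>e::nat. \<forall>u\<in>{0..1}. \<Psi> (of_int i + u + of_int k) = \<Psi> (of_int i + of_int k) + 2 ^ e * u" for i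
  proof -
    obtain e :: nat where
      "\<forall>u\<in>{0..1}. \<Psi> (of_int (i + k) + u) = \<Psi> (of_int (i + k)) + 2 ^ e * u"
      using assms unfolding subdivision_def by blast
    then show ?thesis by (intro exI[of _ e]) (simp add: algebra_simps)
  qed
qed

lemma subdivision_le:
  assumes "subdivision n m \<Psi>"
  shows "n \<le> m"
proof -
  have "\<Psi> (of_int (i + 1)) \<ge> \<Psi> (of_int i) + 1" for i
  proof -
    obtain e :: nat where "\<forall>u\<in>{0..1}. \<Psi> (of_int i + u) = \<Psi> (of_int i) + 2 ^ e * u"
      using assms unfolding subdivision_def by blast
    from bspec[OF this, of 1] show ?thesis by simp
  qed
  then have *: "\<Psi> (real k + 1) \<ge> \<Psi> (real k) + 1" for k by (metis of_int_of_nat_eq of_int_add of_int_1)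
  have "\<Psi> (real k) \<ge> \<Psi> 0 + k" for k
  proof (induction k)
    case (Suc k)
    then show ?case using *[of k] by (simp add: add.commute)
  qed simp
  from this[of n] have "\<Psi> 0 + n \<le> \<Psi> (0 + real n)" by simp
  also have "\<dots> = \<Psi> 0 + real m" using assms unfolding subdivision_def by blast
  finally show ?thesis by simp
qed

text \<open>Leaf \<open>0\<close>, stretched by \<open>2 ^ Suc e\<close>, is cut into two halves,
  which become leaves \<open>0\<close> and \<open>1\<close> of the new circle, each stretched by
  \<open>2 ^ e\<close>. Every later leaf keeps its factor and moves up by one index.\<close>

lemma subdivision_merge:
  assumes \<Psi>: "subdivision n m \<Psi>" and n: "n > 0"
    and e: "\<forall>u\<in>{0..1}. \<Psi> u = \<Psi> 0 + 2 ^ Suc e * u"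
  shows "subdivision (Suc n) m (\<lambda>x. \<Psi> (merge_leaf n x))"
proof (rule subdivisionI)
  have per: "\<Psi> (x + real n) = \<Psi> x + real m" for x using \<Psi> by (simp add: subdivision_def)
  show "\<Psi> (merge_leaf n (x + real (Suc n))) = \<Psi> (merge_leaf n x) + real m" for x
    using merge_leaf_shift[of n x 1] per by simp
  fix i assume i: "i < Suc n"
  have "\<Psi> 0 \<in> \<int>" using \<Psi> unfolding subdivision_def by (metis of_int_0)
  consider "i = 0" | "i = 1" | "i \<ge> 2" by linarith
  then show "\<Psi> (merge_leaf n (real i)) \<in> \<int> \<and> (\<exists>e::nat. \<forall>u\<in>{0..1}.
      \<Psi> (merge_leaf n (real i + u)) = \<Psi> (merge_leaf n (real i)) + 2 ^ e * u)"
  proof cases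
    case 1
    have *: "merge_leaf n u = u / 2" if "u \<in> {0..1}" for u
      using that n by (simp add: merge_leaf_base)
    have "\<Psi> (merge_leaf n u) = \<Psi> 0 + 2 ^ e * u" if "u \<in> {0..1}" for u
      unfolding *[OF that] using that bspec[OF e, of "u / 2"] by simp
    then show ?thesis using 1 *[of 0] \<open>\<Psi> 0 \<in> \<int>\<close> by (auto intro!: exI[of _ e])
  next
    case 2
    have *: "merge_leaf n (1 + u) = (1 + u) / 2" if "u \<in> {0..1}" for u
      using that n by (simp add: merge_leaf_base max_def)
    have **: "\<Psi> (merge_leaf n (1 + u)) = \<Psi> 0 + 2 ^ e + 2 ^ e * u" if "u \<in> {0..1}" for u
      unfolding *[OF that] using that bspec[OF e, of "(1 + u) / 2"] by (simp add: algebra_simps add_divide_distrib)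
    from **[of 0] ** 2 \<open>\<Psi> 0 \<in> \<int>\<close> show ?thesis by (auto intro!: exI[of _ e])
  next
    case 3
    have *: "merge_leaf n (real i + u) = of_int (int i - 1) + u" if "u \<in> {0..1}" for u
      using that n i 3 by (simp add: merge_leaf_base max_def)
    have "merge_leaf n (real i) = of_int (int i - 1)" using *[of 0] by simp
    moreover obtain e' :: nat where "\<forall>u\<in>{0..1}. \<Psi> (of_int (int i - 1) + u) =
        \<Psi> (of_int (int i - 1)) + 2 ^ e' * u" "\<Psi> (of_int (int i - 1)) \<in> \<int>"
      using \<Psi> unfolding subdivision_def by blast
    ultimately show ?thesis using * by metis
  qed
qed simp

text \<open>\<open>H\<close> stands for the lifts of elements of the subgroup generated by the two
  rotations; the goal is \<open>mem_if_subdivision\<close>, which captures the lifts of all elements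
  of T.\<close>

locale lift_group =
  fixes H :: "(real \<Rightarrow> real) set"
  assumes comp_closed: "F \<in> H \<Longrightarrow> F' \<in> H \<Longrightarrow> F \<circ> F' \<in> H"
    and right_inverse: "F \<in> H \<Longrightarrow> \<exists>F'\<in>H. \<forall>x. F (F' x) = x"
    and beta_mem: "beta_lift \<in> H"
    and alpha_mem: "alpha_lift \<in> H"
begin

text \<open>Morphisms \<open>\<real>/n\<int> \<rightarrow> \<real>/m\<int>\<close> (given by a lift) that correspond to an element of \<open>H\<close> when both
  circles are identified with \<open>\<real>/\<int>\<close> via \<^const>\<open>vine\<close>. They form a groupoid.\<close>

definition good :: "nat \<Rightarrow> nat \<Rightarrow> (real \<Rightarrow> real) \<Rightarrow> bool" where
  "good n m \<Theta> \<longleftrightarrow> (\<exists>F\<in>H. \<forall>x. vine m (F x) = \<Theta> (vine n x))"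

lemma id_mem: "(\<lambda>x. x) \<in> H"
proof -
  obtain F' where "F' \<in> H" "\<forall>x. beta_lift (F' x) = x" using right_inverse[OF beta_mem] by blast
  then show ?thesis using comp_closed[OF beta_mem, of F'] by (simp add: comp_def)
qed

lemma good_comp:
  assumes "good m k \<Psi>" "good n m \<Theta>"
  shows "good n k (\<lambda>x. \<Psi> (\<Theta> x))"
proof -
  obtain F F' where "F \<in> H" "\<forall>x. vine k (F x) = \<Psi> (vine m x)"
    "F' \<in> H" "\<forall>x. vine m (F' x) = \<Theta> (vine n x)"
    using assms by (auto simp: good_def)
  then show ?thesis
    unfolding good_def by (intro bexI[of _ "F \<circ> F'"] comp_closed) auto
qed

text \<open>With \<open>F'\<close> a right inverse of \<open>F\<close>, the value
  \<open>vine n (F' x)\<close> is \<open>\<Psi>\<close> of \<open>\<Theta> (vine n (F' x))\<close>,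
  that is \<open>\<Psi>\<close> of \<open>vine m (F (F' x))\<close>.\<close>

lemma good_inv:
  assumes "good n m \<Theta>" "\<And>x. \<Psi> (\<Theta> x) = x"
  shows "good m n \<Psi>"
proof -
  obtain F F' where "\<forall>x. vine m (F x) = \<Theta> (vine n x)" "F' \<in> H" "\<forall>x. F (F' x) = x"
    using assms(1) right_inverse unfolding good_def by blast
  then have "\<forall>x. vine n (F' x) = \<Psi> (vine m x)" using assms(2) by metis
  then show ?thesis using \<open>F' \<in> H\<close> by (auto simp: good_def)
qed

text \<open>\<open>vine (Suc n)\<close> is \<open>split_leaf n\<close> after \<open>vine n\<close>,
  so the splitting of leaf \<open>0\<close> corresponds to the identity of \<open>H\<close>.\<close>

lemma good_split: "n > 0 \<Longrightarrow> good n (Suc n) (split_leaf n)"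
  using id_mem unfolding good_def by (cases n) auto

lemma good_merge: "n > 0 \<Longrightarrow> good (Suc n) n (merge_leaf n)"
  by (rule good_inv[OF good_split]) (simp_all add: merge_leaf_split)

lemma good_id: "good n n (\<lambda>x. x)"
  using id_mem by (auto simp: good_def)

lemma good_shift_int:
  assumes "good n n (\<lambda>x. x + 1)"
  shows "good n n (\<lambda>x. x + of_int k)"
proof (induction k rule: int_induct[where k = 0])
  case base
  show ?case using good_id by simp
next
  case (step1 i)
  then show ?case using good_comp[OF assms step1(2)] by (simp add: add.assoc)
next
  case (step2 i)
  have "good n n (\<lambda>x. x - 1)" by (rule good_inv[OF assms]) simp
  from good_comp[OF this step2(2)] show ?case by (simp add: algebra_simps)
qed

lemma good_shift_3: "good 3 3 (\<lambda>x. x + 1)"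
  using beta_mem vine_beta by (auto simp: good_def)

lemma good_shift_4: "good 4 4 (\<lambda>x. x + 1)"
  using alpha_mem vine_alpha by (auto simp: good_def)

text \<open>\<open>split_leaf_commute\<close> contains one rotation of \<open>n + 2\<close> leaves,
  by \<open>j + 1\<close>; everything else in it is a splitting or a rotation of fewer leaves.
  Solving for it with \<open>j = 1\<close> and \<open>j = 2\<close>, both below \<open>n\<close>,
  gives the rotations by 2 and 3, whose quotient is the rotation by 1.\<close>

lemma good_shift_Suc_Suc:
  assumes "good n n (\<lambda>x. x + 1)" "good (Suc n) (Suc n) (\<lambda>x. x + 1)" "n \<ge> 3"
  shows "good (Suc (Suc n)) (Suc (Suc n)) (\<lambda>x. x + 1)"
proof -
  have *: "good (Suc (Suc n)) (Suc (Suc n)) (\<lambda>x. x + Suc j)" if j: "0 < j" "j < n" for j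
  proof -
    have shift: "good n n (\<lambda>x. x - j)" "good (Suc n) (Suc n) (\<lambda>x. x + j)"
      "good (Suc n) (Suc n) (\<lambda>x. x + Suc j)"
      using good_shift_int[OF assms(1), of "- int j"] good_shift_int[OF assms(2), of "int j"]
        good_shift_int[OF assms(2), of "int (Suc j)"]
      by simp_all
    have split: "good n (Suc n) (split_leaf n)" "good (Suc n) (Suc (Suc n)) (split_leaf (Suc n))"
      using j good_split by simp_all
    from good_comp[OF split(2) good_comp[OF shift(2) good_comp[OF split(1) shift(1)]]]
    have "good n (Suc (Suc n)) (\<lambda>x. split_leaf (Suc n) (split_leaf n x - Suc j) + Suc j)"
      using split_leaf_commute[OF j] by simp
    \<comment> \<open>The inner \<open>split_leaf n\<close> is cancelled first; after a rotation by
      \<open>j + 1\<close> the outer splitting is cancelled in the same way.\<close>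
    from good_comp[OF this good_merge]
    have "good (Suc n) (Suc (Suc n)) (\<lambda>x. split_leaf (Suc n) (x - Suc j) + Suc j)"
      using j by (simp add: split_leaf_merge del: of_nat_Suc)
    from good_comp[OF good_comp[OF this shift(3)] good_merge]
    show ?thesis by (simp add: split_leaf_merge del: of_nat_Suc)
  qed
  have "good (Suc (Suc n)) (Suc (Suc n)) (\<lambda>x. x - 2)"
    by (rule good_inv[OF *[of 1]]) (use assms(3) in auto)
  from good_comp[OF *[of 2] this] assms(3) show ?thesis by (simp add: algebra_simps)
qed

text \<open>From three leaves on, induction starts at the two given rotations. For two leaves and
  one leaf, doubling conjugates the rotation by 1 to the rotation by 2 of four and of two
  leaves.\<close>

lemma good_shift_one: "n > 0 \<Longrightarrow> good n n (\<lambda>x. x + 1)"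
proof -
  have ge3: "good (n + 3) (n + 3) (\<lambda>x. x + 1)" for n
  proof (induction n rule: induct_nat_012)
    case (ge2 n)
    then show ?case using good_shift_Suc_Suc[of "n + 3"] by simp
  qed (use good_shift_3 good_shift_4 in simp_all)
  have "good 2 3 (split_leaf 2)" "good 3 4 (split_leaf 3)"
    using good_split[of 2] good_split[of 3] by simp_all
  from good_comp[OF this(2) good_comp[OF good_shift_3 this(1)]]
  have dbl: "good 2 4 (\<lambda>x. 2 * x + 2)" by (simp add: split_leaf_split_double)
  have "good 4 2 (\<lambda>x. x / 2 - 1)" by (rule good_inv[OF dbl]) (simp add: add_divide_distrib)
  from good_comp[OF this good_comp[OF good_shift_int[OF good_shift_4, of 2] dbl]]
  have two: "good 2 2 (\<lambda>x. x + 1)" by (simp add: add_divide_distrib add.commute)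
  have dbl1: "good 1 2 (\<lambda>x. 2 * x)" using good_split[of 1] by (simp add: split_leaf_1[abs_def, simplified] eval_nat_numeral)
  have "good 2 1 (\<lambda>x. x / 2)" by (rule good_inv[OF dbl1]) simp
  from good_comp[OF this good_comp[OF good_shift_int[OF two, of 2] dbl1]]
  have one: "good 1 1 (\<lambda>x. x + 1)" by (simp add: add_divide_distrib)
  show ?thesis if "n > 0"
  proof (cases "n \<ge> 3")
    case True
    then show ?thesis using ge3[of "n - 3"] by simp
  next
    case False
    then have "n = 1 \<or> n = 2" using that by auto
    then show ?thesis using one two by blast
  qed
qed

lemmas good_shift = good_shift_int[OF good_shift_one]

text \<open>Induction on the number of splittings still to be made. If no leaf is stretched, the map
  is a translation. Otherwise halving a stretched leaf leaves one splitting fewer, and the halving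
  is undone by \<open>split_leaf\<close>.\<close>

lemma good_subdivision:
  assumes "subdivision n m \<Psi>" "n > 0"
  shows "good n m \<Psi>"
  using assms
proof (induction "m - n" arbitrary: n \<Psi> rule: less_induct)
  case less
  note \<Psi> = \<open>subdivision n m \<Psi>\<close>
  have per: "\<Psi> (x + real n) = \<Psi> x + real m" for x using \<Psi> by (simp add: subdivision_def)
  have "\<exists>e::int \<Rightarrow> nat. \<forall>i. \<forall>u\<in>{0..1}. \<Psi> (of_int i + u) = \<Psi> (of_int i) + 2 ^ e i * u"
    using \<Psi> unfolding subdivision_def by (intro choice) blast
  then obtain e :: "int \<Rightarrow> nat"
    where e: "\<And>i u. u \<in> {0..1} \<Longrightarrow> \<Psi> (of_int i + u) = \<Psi> (of_int i) + 2 ^ e i * u" by blast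
  show ?case
  proof (cases "\<forall>i. e i = 0")
    case True
    obtain c where c: "\<Psi> 0 = of_int c"
      using \<Psi> unfolding subdivision_def by (metis Ints_cases of_int_0)
    have "\<Psi> (of_int i) = \<Psi> 0 + of_int i" for i
    proof -
      have "\<Psi> (x + 1) = \<Psi> x + 1" for x
      proof -
        have x: "x = of_int \<lfloor>x\<rfloor> + frac x" "frac x \<in> {0..1}"
          using frac_lt_1[of x] by (auto simp: frac_def)
        have "\<Psi> (x + 1) = \<Psi> (of_int (\<lfloor>x\<rfloor> + 1) + frac x)" by (simp add: frac_def add.commute)
        also have "\<dots> = \<Psi> (of_int \<lfloor>x\<rfloor> + 1) + frac x"
          using e[OF x(2), of "\<lfloor>x\<rfloor> + 1"] True by simp
        also have "\<dots> = \<Psi> (of_int \<lfloor>x\<rfloor>) + 1 + frac x" using e[of 1 "\<lfloor>x\<rfloor>"] True by simp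
        also have "\<dots> = \<Psi> (of_int \<lfloor>x\<rfloor> + frac x) + 1" using e[OF x(2), of "\<lfloor>x\<rfloor>"] True by simp
        finally show ?thesis by (simp flip: x(1))
      qed
      from periodic_shift_int[of \<Psi>, OF this, of 0 i] show ?thesis by simp
    qed
    then have trans: "\<Psi> x = x + of_int c" for x
      using e[of "frac x" "\<lfloor>x\<rfloor>"] frac_lt_1[of x] True c by (simp add: frac_def)
    have "n = m" using per[of 0] by (simp add: trans)
    then show ?thesis using good_shift[OF \<open>n > 0\<close>, of c] trans[abs_def] by simp
  next
    case False
    then obtain i k where i: "e i = Suc k" by (meson not0_implies_Suc)
    \<comment> \<open>The stretched leaf \<open>i\<close> is rotated to position \<open>0\<close>,
      where \<open>subdivision_merge\<close> acts.\<close>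
    define \<Phi> where "\<Phi> x = \<Psi> (x + of_int i)" for x
    have "subdivision (Suc n) m (\<lambda>x. \<Phi> (merge_leaf n x))"
    proof (rule subdivision_merge)
      show "subdivision n m \<Phi>" unfolding \<Phi>_def by (rule subdivision_translate[OF \<Psi>])
      show "\<forall>u\<in>{0..1}. \<Phi> u = \<Phi> 0 + 2 ^ Suc k * u"
        using e[of _ i] i by (simp add: \<Phi>_def add.commute)
    qed fact
    moreover from subdivision_le[OF this] have "m - Suc n < m - n" by simp
    ultimately have "good (Suc n) m (\<lambda>x. \<Phi> (merge_leaf n x))" using less.hyps by simp
    from good_comp[OF this good_split[OF \<open>n > 0\<close>]]
    have "good n m \<Phi>" using \<open>n > 0\<close> by (simp add: merge_leaf_split)
    from good_comp[OF this good_shift[OF \<open>n > 0\<close>, of "-i"]]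
    show ?thesis by (simp add: \<Phi>_def)
  qed
qed

text \<open>Scaling by \<open>2 ^ k\<close> is itself a subdivision of a single leaf. Thus
  \<open>F\<close> is a composition of good maps from R/Z to R/Z, and \<open>vine 1\<close> is the
  identity.\<close>

lemma mem_if_subdivision:
  assumes F: "subdivision (2 ^ N) (2 ^ M) (\<lambda>x. 2 ^ M * F (x / 2 ^ N))"
  shows "F \<in> H"
proof -
  have scale: "good 1 (2 ^ k) (\<lambda>x. 2 ^ k * x)" for k
    by (intro good_subdivision subdivisionI)
      (auto simp: algebra_simps intro!: exI[of _ k])
  have "good (2 ^ M) 1 (\<lambda>x. x / 2 ^ M)" by (rule good_inv[OF scale]) simp
  from good_comp[OF this good_comp[OF good_subdivision[OF F] scale]]
  have "good 1 1 F" by simp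
  then obtain F' where "F' \<in> H" "\<And>x. F' x = F x" by (auto simp: good_def)
  then show ?thesis by (metis ext)
qed

end

section \<open>Circle maps given by lifts\<close>

text \<open>Open sets of the circle are described on [0, 1]. A neighbourhood of an integer on the
  line therefore combines a right half-neighbourhood of 0 with a left one of 1; elsewhere one
  neighbourhood inside the period is enough.\<close>

lemma continuous_map_frac: "continuous_map euclideanreal circle_topology frac"
  unfolding continuous_map
proof (intro conjI allI impI)
  fix U assume U: "openin circle_topology U"
  define A where "A = {x \<in> {0..1}. frac x \<in> U}"
  have A: "openin (top_of_set {0..1}) A" using U by (simp add: openin_circle_topology A_def)
  have near: "\<exists>e>0. \<forall>y\<in>{0..1}. dist y x < e \<longrightarrow> y \<in> A" if "x \<in> A" for x
    using A that unfolding openin_euclidean_subtopology_iff by blast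
  have "open {x. frac x \<in> U}"
    unfolding open_dist
  proof
    fix x :: real assume "x \<in> {x. frac x \<in> U}"
    define t k where "t = frac x" and "k = \<lfloor>x\<rfloor>"
    have x: "x = t + of_int k" by (simp add: t_def k_def frac_def)
    have t: "0 \<le> t" "t < 1" "frac t \<in> U"
      using \<open>x \<in> _\<close> by (auto simp: t_def frac_lt_1)
    have inU: "frac (y - of_int k) \<in> U \<Longrightarrow> frac y \<in> U" for y
      using frac_add_int_right[of "of_int (- k)" y] by simp
    obtain e where e: "e > 0" "\<forall>y\<in>{0..1}. dist y t < e \<longrightarrow> y \<in> A"
      using near[of t] t by (auto simp: A_def)
    show "\<exists>e>0. \<forall>y. dist y x < e \<longrightarrow> y \<in> {x. frac x \<in> U}"
    proof (cases "t = 0")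
      case True
      then obtain e' where e': "e' > 0" "\<forall>y\<in>{0..1}. dist y 1 < e' \<longrightarrow> y \<in> A"
        using near[of 1] t by (auto simp: A_def)
      have "frac y \<in> U" if y: "dist y x < min (min e e') 1" for y
      proof (rule inU)
        define z where "z = y - of_int k"
        have z: "\<bar>z\<bar> < e" "\<bar>z\<bar> < e'" "\<bar>z\<bar> < 1"
          using y x True by (auto simp: z_def dist_real_def)
        show "frac (y - of_int k) \<in> U"
        proof (cases "z \<ge> 0")
          case nonneg: True
          then have "z \<in> A" using e(2) z True by (auto simp: dist_real_def)
          then show ?thesis by (simp add: A_def z_def)
        next
          case False
          then have "z + 1 \<in> A" using e'(2) z by (auto simp: dist_real_def)
          then show ?thesis using frac_add_int_right[of 1 z] by (simp add: A_def z_def)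
        qed
      qed
      then show ?thesis using e(1) e'(1) by (intro exI[of _ "min (min e e') 1"]) auto
    next
      case False
      have "frac y \<in> U" if y: "dist y x < min e (min t (1 - t))" for y
      proof (rule inU)
        have "y - of_int k \<in> {0..1}" "dist (y - of_int k) t < e"
          using y unfolding x dist_real_def by (auto simp: abs_if split: if_splits)
        then have "y - of_int k \<in> A" using e(2) by blast
        then show "frac (y - of_int k) \<in> U" by (simp add: A_def)
      qed
      then show ?thesis using e(1) t False by (intro exI[of _ "min e (min t (1 - t))"]) auto
    qed
  qed
  then show "openin euclideanreal {x \<in> topspace euclideanreal. frac x \<in> U}" by simp
qed auto

definition circle_map :: "(real \<Rightarrow> real) \<Rightarrow> real \<Rightarrow> real" where
  "circle_map F = (\<lambda>x\<in>circle. frac (F x))"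

lemma frac_periodic:
  assumes "\<And>x. F (x + 1) = F x + (1::real)"
  shows "frac (F x) = circle_map F (frac x)"
proof -
  have "F x = F (frac x) + of_int \<lfloor>x\<rfloor>"
    using periodic_shift_int[of F, OF assms, of "frac x" "\<lfloor>x\<rfloor>"] by (simp add: frac_def)
  then show ?thesis by (simp add: circle_map_def frac_add_int_right)
qed

lemma continuous_map_circle_map:
  assumes F: "continuous_on UNIV F" "\<And>x. F (x + 1) = F x + (1::real)"
  shows "continuous_map circle_topology circle_topology (circle_map F)"
proof -
  have "continuous_map (top_of_set {0..1}) circle_topology (frac \<circ> F)"
    by (rule continuous_map_compose[OF _ continuous_map_frac])
      (use F(1) continuous_on_subset in auto)
  then have "continuous_map (top_of_set {0..1}) circle_topology (circle_map F \<circ> frac)"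
    using frac_periodic[of F, OF F(2)] by (simp add: o_def)
  then show ?thesis
    using continuous_compose_quotient_map_eq[OF quotient_map_circle] by blast
qed

lemma periodic_strict_mono:
  fixes F :: "real \<Rightarrow> real"
  assumes per: "\<And>x. F (x + 1) = F x + 1" and mono: "strict_mono_on {0..1} F"
  shows "strict_mono F"
proof (rule strict_monoI)
  fix x y :: real assume "x < y"
  have F: "F z = F (frac z) + of_int \<lfloor>z\<rfloor>" for z
    using periodic_shift_int[of F, OF per, of "frac z" "\<lfloor>z\<rfloor>"] by (simp add: frac_def)
  have fr: "0 \<le> frac z" "frac z < 1" for z :: real by (auto simp: frac_lt_1)
  show "F x < F y"
  proof (cases "\<lfloor>x\<rfloor> = \<lfloor>y\<rfloor>")
    case True
    then have "frac x < frac y" using \<open>x < y\<close> by (simp add: frac_def)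
    then have "F (frac x) < F (frac y)" using strict_mono_onD[OF mono] fr by (meson atLeastAtMost_iff less_imp_le)
    then show ?thesis using F[of x] F[of y] True by simp
  next
    case False
    then have "\<lfloor>x\<rfloor> + 1 \<le> \<lfloor>y\<rfloor>" using \<open>x < y\<close> floor_mono[of x y] by linarith
    then have "of_int \<lfloor>x\<rfloor> + 1 \<le> (of_int \<lfloor>y\<rfloor> :: real)" by linarith
    moreover have "F (frac x) < F 1" using strict_mono_onD[OF mono] fr[of x] by simp
    moreover have "F 1 = F 0 + 1" using per[of 0] by simp
    moreover have "F 0 \<le> F (frac y)"
      using strict_mono_onD[OF mono, of 0 "frac y"] fr[of y]
      by (metis atLeastAtMost_iff less_eq_real_def order_refl zero_le_one)
    ultimately show ?thesis using F[of x] F[of y] by linarith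
  qed
qed

lemma periodic_surj:
  fixes F :: "real \<Rightarrow> real"
  assumes per: "\<And>x. F (x + 1) = F x + 1" and cont: "continuous_on {0..1} F"
  shows "surj F"
proof -
  have "\<exists>x. y = F x" for y
  proof -
    define k where "k = \<lfloor>y - F 0\<rfloor>"
    have "F 0 \<le> y - of_int k" "y - of_int k \<le> F 1"
      using per[of 0] unfolding k_def by (auto simp: algebra_simps) linarith+
    then obtain x where "F x = y - of_int k" using IVT'[of F 0 _ 1] cont by auto
    then have "F (x + of_int k) = y"
      using periodic_shift_int[of F, OF per, of x k] by simp
    then show ?thesis by metis
  qed
  then show ?thesis by (auto simp: surj_def)
qed

lemma strict_mono_surj_continuous:
  fixes F :: "real \<Rightarrow> real"
  assumes "strict_mono F" "surj F"
  shows "continuous_on UNIV F"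
  by (rule continuous_onI_mono) (use assms in \<open>auto simp: strict_mono_less_eq\<close>)

text \<open>The inverse of \<open>F\<close> is again a periodic, increasing bijection, hence
  continuous, and it induces the inverse circle map; this gives the homeomorphism.\<close>

lemma circle_map_thompson_T:
  assumes per: "\<And>x. F (x + 1) = F x + 1" and mono: "strict_mono F" and surj: "surj F"
    and dy: "F ` dyadic_rationals \<subseteq> dyadic_rationals"
    and B: "finite B" "B \<subseteq> circle_dyadics" "dyadic_PL_off B F"
  shows "circle_map F \<in> thompson_T_maps"
proof -
  define G where "G = inv_into UNIV F"
  have FG: "F (G y) = y" for y using surj by (simp add: G_def surj_f_inv_f)
  have inj: "inj F" using mono by (rule strict_mono_imp_inj_on)
  then have GF: "G (F x) = x" for x by (simp add: G_def)
  have Gm: "strict_mono G"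
    using mono FG by (metis (no_types, lifting) strict_mono_def strict_mono_less)
  have "surj G" using inj by (simp add: G_def inj_imp_surj_inv)
  have Gper: "G (y + 1) = G y + 1" for y by (metis per FG GF)
  have cont: "continuous_on UNIV F" "continuous_on UNIV G"
    using strict_mono_surj_continuous mono surj Gm \<open>surj G\<close> by auto
  have fF: "frac (F x) = circle_map F (frac x)" for x by (rule frac_periodic[of F, OF per])
  have fG: "frac (G x) = circle_map G (frac x)" for x by (rule frac_periodic[of G, OF Gper])
  have GFc: "circle_map G (circle_map F x) = x" if "x \<in> circle" for x
    using fF[of x] fG[of "F x"] that GF by simp
  have FGc: "circle_map F (circle_map G x) = x" if "x \<in> circle" for x
    using fG[of x] fF[of "G x"] that FG by simp
  have mem: "circle_map F x \<in> circle" "circle_map G x \<in> circle" if "x \<in> circle" for x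
    using that by (simp_all add: circle_map_def)
  have "homeomorphic_maps circle_topology circle_topology (circle_map F) (circle_map G)"
    unfolding homeomorphic_maps_def
    using continuous_map_circle_map[of F, OF cont(1) per] continuous_map_circle_map[of G, OF cont(2) Gper]
      GFc FGc by simp
  then have "homeomorphic_map circle_topology circle_topology (circle_map F)"
    using homeomorphic_maps_map by blast
  moreover have "circle_map F \<in> Bij circle"
  proof -
    have "bij_betw (circle_map F) circle circle"
      by (rule bij_betw_byWitness[of _ "circle_map G"]) (use GFc FGc mem in auto)
    then show ?thesis by (simp add: Bij_def circle_map_def)
  qed
  moreover have "circle_map F ` circle_dyadics \<subseteq> circle_dyadics"
    using dy by (auto simp: circle_map_def circle_dyadics_iff frac_dyadic_iff image_subset_iff)
  moreover have "orientation_preserving_lift (circle_map F) F"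
    using cont mono per fF by (simp add: orientation_preserving_lift_def)
  ultimately show ?thesis using B unfolding thompson_T_maps_def by blast
qed

section \<open>Lifts with dyadic affine pieces\<close>

definition affine_on :: "real set \<Rightarrow> (real \<Rightarrow> real) \<Rightarrow> bool" where
  "affine_on S F \<longleftrightarrow> (\<exists>i::int. \<exists>d\<in>dyadic_rationals. \<forall>x\<in>S. F x = 2 powi i * x + d)"

lemma affine_on_PL:
  assumes per: "\<And>x. F (x + 1) = F x + 1" and F: "affine_on {l..r} F"
  obtains i :: int and d where "\<forall>x\<in>{l + of_int k..r + of_int k}. F x = 2 powi i * x + d"
proof -
  obtain i :: int and d where "\<forall>x\<in>{l..r}. F x = 2 powi i * x + d"
    using F unfolding affine_on_def by blast
  then have "F x = 2 powi i * x + (d + of_int k - 2 powi i * of_int k)"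
    if "x \<in> {l + of_int k..r + of_int k}" for x
    using that periodic_shift_int[of F, OF per, of "x - of_int k" k] by (simp add: right_diff_distrib)
  then show thesis using that by blast
qed

text \<open>A criterion shared by the two rotations. The closed pieces overlap in the break points,
  which yields continuity; the dyadic offsets keep dyadic points dyadic.\<close>

lemma three_piece_thompson_T:
  assumes per: "\<And>x. F (x + 1) = F x + 1"
    and pq: "0 < p" "p < q" "q < 1" "p \<in> dyadic_rationals" "q \<in> dyadic_rationals"
    and F: "affine_on {0..p} F" "affine_on {p..q} F" "affine_on {q..1} F"
  shows "circle_map F \<in> thompson_T_maps" "bij F"
proof -
  have mono: "x < y \<Longrightarrow> F x < F y" if "affine_on S F" "x \<in> S" "y \<in> S" for x y S
  proof -
    obtain i :: int and d where "\<forall>x\<in>S. F x = 2 powi i * x + d"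
      using \<open>affine_on S F\<close> unfolding affine_on_def by blast
    then show "x < y \<Longrightarrow> F x < F y" using that by (simp add: mult_strict_left_mono)
  qed
  have "strict_mono_on {0..1} F"
  proof (rule strict_mono_onI)
    fix x y :: real assume *: "x \<in> {0..1}" "y \<in> {0..1}" "x < y"
    note m = mono[OF F(1)] mono[OF F(2)] mono[OF F(3)]
    consider "y \<le> p" | "x \<le> p" "p < y" "y \<le> q" | "x \<le> p" "q < y" | "p < x" "y \<le> q"
      | "p < x" "x \<le> q" "q < y" | "q < x"
      by linarith
    then show "F x < F y"
    proof cases
      case 1 then show ?thesis using * m(1)[of x y] by simp
    next
      case 2 then show ?thesis using * pq m(1)[of x p] m(2)[of p y] by (cases "x = p") auto
    next
      case 3 then show ?thesis
        using * pq m(1)[of x p] m(2)[of p q] m(3)[of q y] by (cases "x = p") auto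
    next
      case 4 then show ?thesis using * m(2)[of x y] by simp
    next
      case 5 then show ?thesis using * pq m(2)[of x q] m(3)[of q y] by (cases "x = q") auto
    next
      case 6 then show ?thesis using * m(3)[of x y] by simp
    qed
  qed
  then have sm: "strict_mono F" by (rule periodic_strict_mono[of F, OF per])
  have "continuous_on S F" if "affine_on S F" for S
  proof -
    obtain i :: int and d where "\<forall>x\<in>S. F x = 2 powi i * x + d"
      using \<open>affine_on S F\<close> unfolding affine_on_def by blast
    then show ?thesis by (subst continuous_on_cong[OF refl, of _ _ "\<lambda>x. 2 powi i * x + d"])
      (auto intro!: continuous_intros)
  qed
  then have "continuous_on ({0..p} \<union> {p..q} \<union> {q..1}) F"
    using F by (intro continuous_on_closed_Un) auto
  moreover have "{0..p} \<union> {p..q} \<union> {q..1} = {0..1}" using pq by auto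
  ultimately have surj: "surj F" using periodic_surj[of F, OF per] by metis
  show "bij F" using sm surj strict_mono_imp_inj_on by (auto simp: bij_def)
  have "F ` dyadic_rationals \<subseteq> dyadic_rationals"
  proof (intro image_subsetI)
    fix x assume "x \<in> dyadic_rationals"
    then have fx: "frac x \<in> dyadic_rationals" by (simp add: frac_dyadic_iff)
    have dyp: "F z \<in> dyadic_rationals" if "affine_on S F" "z \<in> S" "z \<in> dyadic_rationals" for z S
      using that dyadic_add dyadic_mult dyadic_powi unfolding affine_on_def by metis
    have "frac x \<in> {0..p} \<union> {p..q} \<union> {q..1}" using frac_lt_1[of x] by auto
    then have "F (frac x) \<in> dyadic_rationals" using dyp F fx by blast
    moreover have "F x = F (frac x) + of_int \<lfloor>x\<rfloor>"
      using periodic_shift_int[of F, OF per, of "frac x" "\<lfloor>x\<rfloor>"] by (simp add: frac_def)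
    ultimately show "F x \<in> dyadic_rationals" using dyadic_add dyadic_int by metis
  qed
  moreover have "{0, p, q} \<subseteq> circle_dyadics"
    using pq dyadic_int[of 0] by (auto simp: circle_dyadics_iff circle_def)
  moreover have "dyadic_PL_off {0, p, q} F"
  proof -
    \<comment> \<open>A point off the break points is strictly inside a translate of one piece.
      Since the ends of that translate project to break points, an interval around the point that
      avoids them stays within it.\<close>
    have piece: "\<exists>l r. l \<in> {0, p, q} \<and> r \<in> {p, q, 1} \<and> affine_on {l..r} F \<and>
        l + of_int \<lfloor>x\<rfloor> < x \<and> x < r + of_int \<lfloor>x\<rfloor>" if "frac x \<notin> {0, p, q}" for x
    proof -
      have fr: "x = frac x + of_int \<lfloor>x\<rfloor>" "frac x > 0" "frac x < 1"
        using that frac_ge_0[of x] frac_lt_1[of x] by (simp add: frac_def, force, simp)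
      have "frac x < p \<or> (p < frac x \<and> frac x < q) \<or> q < frac x" using that by auto
      moreover have "0 + of_int \<lfloor>x\<rfloor> < x" "x < 1 + of_int \<lfloor>x\<rfloor>"
        "(a + of_int \<lfloor>x\<rfloor> < x) = (a < frac x)" "(x < a + of_int \<lfloor>x\<rfloor>) = (frac x < a)" for a
        using fr by linarith+
      ultimately show ?thesis using F by (metis insertI1 insertI2)
    qed
    have br: "frac (z + of_int k) \<in> {0, p, q}" if "z \<in> {0, p, q, 1}" for z k
      using that pq by (auto simp: frac_add_int_right frac_eq_id)
    show ?thesis
      unfolding dyadic_PL_off_def
    proof (intro conjI allI impI)
      fix a b :: real assume ab: "\<forall>x\<in>{a<..<b}. frac x \<notin> {0, p, q}"
      show "\<exists>c d. \<forall>x\<in>{a<..<b}. F x = c * x + d"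
      proof (cases "a < b")
        case True
        define x where "x = (a + b) / 2"
        have x: "x \<in> {a<..<b}" using True by (simp add: x_def)
        obtain l r where lr: "l \<in> {0, p, q}" "r \<in> {p, q, 1}" "affine_on {l..r} F"
          "l + of_int \<lfloor>x\<rfloor> < x" "x < r + of_int \<lfloor>x\<rfloor>" using piece ab x by blast
        have "l + of_int \<lfloor>x\<rfloor> \<notin> {a<..<b}" "r + of_int \<lfloor>x\<rfloor> \<notin> {a<..<b}"
          using ab br[of l "\<lfloor>x\<rfloor>"] br[of r "\<lfloor>x\<rfloor>"] lr(1,2) by blast+
        then have "{a<..<b} \<subseteq> {l + of_int \<lfloor>x\<rfloor>..r + of_int \<lfloor>x\<rfloor>}" using lr x by auto
        then show ?thesis using affine_on_PL[of F, OF per lr(3), of "\<lfloor>x\<rfloor>"] by (metis subsetD)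
      qed auto
    next
      fix x :: real assume "frac x \<notin> {0, p, q}"
      then obtain l r where lr: "affine_on {l..r} F"
          "l + of_int \<lfloor>x\<rfloor> < x" "x < r + of_int \<lfloor>x\<rfloor>" using piece by blast
      obtain i :: int and d where
        F: "\<forall>y\<in>{l + of_int \<lfloor>x\<rfloor>..r + of_int \<lfloor>x\<rfloor>}. F y = 2 powi i * y + d"
        using affine_on_PL[of F, OF per lr(1), of "\<lfloor>x\<rfloor>"] by blast
      have "((\<lambda>y. 2 powi i * y + d) has_real_derivative 2 powi i) (at x)"
        by (auto intro!: derivative_eq_intros)
      then have "(F has_real_derivative 2 powi i) (at x)"
        by (rule has_field_derivative_transform_within_open[of _ _ _ "{l + of_int \<lfloor>x\<rfloor><..<r + of_int \<lfloor>x\<rfloor>}"])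
          (use F lr in auto)
      then show "\<exists>i::int. (F has_real_derivative 2 powi i) (at x)" by blast
    qed
  qed
  ultimately show "circle_map F \<in> thompson_T_maps"
    by (intro circle_map_thompson_T[of F "{0, p, q}"] per sm surj) auto
qed

lemma affine_onI:
  assumes "\<And>x. x \<in> S \<Longrightarrow> F x = 2 powi i * x + of_int m / 2 ^ k"
  shows "affine_on S F"
  using assms unfolding affine_on_def by blast

lemma beta_thompson_T: "circle_map beta_lift \<in> thompson_T_maps" and bij_beta_lift: "bij beta_lift"
proof -
  have *: "1/4 \<in> dyadic_rationals" "1/2 \<in> dyadic_rationals"
    using dyadicsI[of 1 2] dyadicsI[of 1 1] by simp_all
  \<comment> \<open>The three numbers are the exponent of the slope, and the numerator and the
    exponent of the denominator of the offset, here 1/4.\<close>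
  have "affine_on {0..1/4} beta_lift" by (rule affine_onI[of _ _ 0 1 2]) (auto simp: beta_lift_base)
  moreover have "affine_on {1/4..1/2} beta_lift"
    by (rule affine_onI[of _ _ 1 0 0]) (auto simp: beta_lift_base)
  moreover have "affine_on {1/2..1} beta_lift"
    by (rule affine_onI[of _ _ "-1" 3 2]) (auto simp: beta_lift_base power_int_minus)
  ultimately show "circle_map beta_lift \<in> thompson_T_maps" "bij beta_lift"
    using three_piece_thompson_T[of beta_lift "1/4" "1/2"] beta_lift_shift[of _ 1] * by simp_all
qed

lemma alpha_thompson_T: "circle_map alpha_lift \<in> thompson_T_maps" and bij_alpha_lift: "bij alpha_lift"
proof -
  have *: "1/8 \<in> dyadic_rationals" "1/2 \<in> dyadic_rationals"
    using dyadicsI[of 1 3] dyadicsI[of 1 1] by simp_all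
  have "affine_on {0..1/8} alpha_lift" by (rule affine_onI[of _ _ 0 1 3]) (auto simp: alpha_lift_base)
  moreover have "affine_on {1/8..1/2} alpha_lift"
    by (rule affine_onI[of _ _ 1 0 0]) (auto simp: alpha_lift_base)
  moreover have "affine_on {1/2..1} alpha_lift"
    by (rule affine_onI[of _ _ "-2" 7 3]) (auto simp: alpha_lift_base power_int_minus)
  ultimately show "circle_map alpha_lift \<in> thompson_T_maps" "bij alpha_lift"
    using three_piece_thompson_T[of alpha_lift "1/8" "1/2"] alpha_lift_shift[of _ 1] * by simp_all
qed

section \<open>Generation of T\<close>

lemma dyadic_common_denominator:
  assumes "finite D" "D \<subseteq> dyadic_rationals"
  obtains N where "\<And>x. x \<in> D \<Longrightarrow> 2 ^ N * x \<in> \<int>"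
proof -
  have "\<exists>N. \<forall>x\<in>D. 2 ^ N * x \<in> \<int>"
    using assms
  proof (induction D)
    case (insert x D)
    then obtain N where N: "\<forall>y\<in>D. 2 ^ N * y \<in> \<int>" by auto
    obtain m k where x: "x = of_int m / 2 ^ k" using insert.prems by (auto simp: dyadic_rationals_def)
    have "2 ^ (N + k) * y \<in> \<int>" if "y \<in> D" for y
    proof -
      have "2 ^ k * (2 ^ N * y) \<in> \<int>" using N that by (intro Ints_mult[of "2 ^ k" "2 ^ N * y"]) auto
      then show ?thesis by (simp add: power_add mult_ac)
    qed
    moreover have "2 ^ (N + k) * x = of_int (2 ^ N * m)" by (simp add: x power_add)
    then have "2 ^ (N + k) * x \<in> \<int>" by (metis Ints_of_int)
    ultimately show ?case by blast
  qed simp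
  then show thesis using that by blast
qed

text \<open>The break points are multiples of \<open>1 / 2 ^ N\<close> modulo 1, so none lies
  strictly between neighbouring multiples. The derivative at the midpoint identifies the slope, and
  continuity extends the formula to the closed interval.\<close>

lemma lift_affine_piece:
  assumes lift: "orientation_preserving_lift g F" and PL: "dyadic_PL_off B F"
    and N: "\<And>b. b \<in> B \<Longrightarrow> 2 ^ N * b \<in> \<int>"
  shows "\<exists>e::int. \<forall>u\<in>{0..1}. F ((of_int i + u) / 2 ^ N) = F (of_int i / 2 ^ N) + 2 powi e * u"
proof -
  define a b where "a = of_int i / (2 ^ N :: real)" and "b = (of_int i + 1) / (2 ^ N :: real)"
  have ab: "a < b" by (simp add: a_def b_def divide_strict_right_mono)
  have avoid: "frac x \<notin> B" if x: "x \<in> {a<..<b}" for x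
  proof
    assume "frac x \<in> B"
    then have "2 ^ N * frac x + of_int (2 ^ N * \<lfloor>x\<rfloor>) \<in> \<int>" using N by (intro Ints_add) auto
    moreover have "2 ^ N * frac x + of_int (2 ^ N * \<lfloor>x\<rfloor>) = 2 ^ N * x"
      by (simp add: frac_def right_diff_distrib)
    ultimately obtain j where j: "2 ^ N * x = of_int j" by (metis Ints_cases)
    have "of_int i < 2 ^ N * x" "2 ^ N * x < of_int i + 1"
      using x by (auto simp: a_def b_def field_simps)
    then have "of_int i < (of_int j :: real)" "of_int j < (of_int (i + 1) :: real)"
      unfolding j by simp_all
    then show False unfolding of_int_less_iff by simp
  qed
  then obtain c d where cd: "\<forall>x\<in>{a<..<b}. F x = c * x + d"
    using PL unfolding dyadic_PL_off_def by blast
  define m where "m = (a + b) / 2"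
  have m: "m \<in> {a<..<b}" using ab by (simp add: m_def)
  obtain e :: int where e: "(F has_real_derivative 2 powi e) (at m)"
    using PL avoid[OF m] unfolding dyadic_PL_off_def by blast
  have "((\<lambda>x. c * x + d) has_real_derivative c) (at m)" by (auto intro!: derivative_eq_intros)
  then have "(F has_real_derivative c) (at m)"
    by (rule has_field_derivative_transform_within_open[of _ _ _ "{a<..<b}"]) (use cd m in auto)
  then have c: "c = 2 powi e" using e by (rule DERIV_unique)
  have "closed {x. F x = c * x + d}"
    using lift unfolding orientation_preserving_lift_def
    by (intro closed_Collect_eq) (auto intro!: continuous_intros)
  then have "closure {a<..<b} \<subseteq> {x. F x = c * x + d}" using cd by (intro closure_minimal) auto
  then have F: "F x = c * x + d" if "x \<in> {a..b}" for x
    using that ab by (auto simp: closure_greaterThanLessThan)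
  have "F ((of_int i + u) / 2 ^ N) = F (of_int i / 2 ^ N) + 2 powi (e - int N) * u"
    if u: "u \<in> {0..1}" for u
  proof -
    have "(of_int i + u) / 2 ^ N \<in> {a..b}" "of_int i / 2 ^ N \<in> {a..b}"
      using u by (auto simp: a_def b_def intro!: divide_right_mono)
    then show ?thesis by (simp add: F c power_int_diff add_divide_distrib distrib_left)
  qed
  then show ?thesis by blast
qed

lemma lift_subdivision:
  assumes lift: "orientation_preserving_lift g F" and PL: "dyadic_PL_off B F"
    and B: "finite B" "B \<subseteq> circle_dyadics" and dy: "g ` circle_dyadics \<subseteq> circle_dyadics"
  obtains N M where "subdivision (2 ^ N) (2 ^ M) (\<lambda>x. 2 ^ M * F (x / 2 ^ N))"
proof -
  have "B \<subseteq> dyadic_rationals" using B(2) by (auto simp: circle_dyadics_iff)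
  then obtain N where N: "\<And>b. b \<in> B \<Longrightarrow> 2 ^ N * b \<in> \<int>"
    using dyadic_common_denominator[OF B(1)] by blast
  have "\<exists>e::int. \<forall>u\<in>{0..1}. F ((real i + u) / 2 ^ N) = F (real i / 2 ^ N) + 2 powi e * u" for i
    using lift_affine_piece[OF lift PL N, of "int i"] by simp
  then obtain e :: "nat \<Rightarrow> int" where e: "\<And>i u. u \<in> {0..1} \<Longrightarrow>
      F ((real i + u) / 2 ^ N) = F (real i / 2 ^ N) + 2 powi e i * u" by metis
  have Fd: "F x \<in> dyadic_rationals" if "x \<in> dyadic_rationals" for x
  proof -
    have "frac (F x) = g (frac x)" using lift by (simp add: orientation_preserving_lift_def)
    then have "frac (F x) \<in> circle_dyadics" using dy frac_dyadics_iff that by auto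
    then show ?thesis by (simp add: frac_dyadics_iff)
  qed
  let ?D = "(\<lambda>i. F (real i / 2 ^ N)) ` {..<2 ^ N}"
  have "real i / 2 ^ N \<in> dyadic_rationals" for i using dyadicsI[of "int i" N] by simp
  then have "?D \<subseteq> dyadic_rationals" using Fd by blast
  then obtain K where "\<And>x. x \<in> ?D \<Longrightarrow> 2 ^ K * x \<in> \<int>"
    using dyadic_common_denominator[of ?D] by (meson finite_imageI finite_lessThan)
  then have K: "2 ^ K * F (real i / 2 ^ N) \<in> \<int>" if "i < 2 ^ N" for i using that by simp
  \<comment> \<open>\<open>K\<close> makes the grid values integral. The sum bounds each
    \<open>nat (- e i)\<close>, so scaling by \<open>2 ^ M\<close> turns every slope into a natural
    power of two.\<close>
  define M where "M = K + (\<Sum>i<2 ^ N. nat (- e i))"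
  have "subdivision (2 ^ N) (2 ^ M) (\<lambda>x. 2 ^ M * F (x / 2 ^ N))"
  proof (rule subdivisionI)
    have "F (x + 1) = F x + 1" for x using lift by (simp add: orientation_preserving_lift_def)
    then show "2 ^ M * F ((x + real (2 ^ N)) / 2 ^ N) = 2 ^ M * F (x / 2 ^ N) + real (2 ^ M)" for x
      by (simp add: add_divide_distrib distrib_left)
    fix i :: nat assume i: "i < 2 ^ N"
    have "nat (- e i) \<le> (\<Sum>i<2 ^ N. nat (- e i))" using i by (intro member_le_sum) auto
    then have "nat (- e i) \<le> M" unfolding M_def by (rule trans_le_add2)
    then have "int M + e i \<ge> 0" by linarith
    then have pow: "2 ^ M * 2 powi e i = (2 ^ nat (int M + e i) :: real)"
      by (simp add: power_int_add flip: power_int_of_nat)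
    have "2 ^ (M - K) * (2 ^ K * F (real i / 2 ^ N)) \<in> \<int>"
      using K[OF i] by (intro Ints_mult[of "2 ^ (M - K)"]) auto
    moreover have "2 ^ (M - K) * (2 ^ K * F (real i / 2 ^ N)) = 2 ^ M * F (real i / 2 ^ N)"
      by (simp add: M_def power_add)
    ultimately have int: "2 ^ M * F (real i / 2 ^ N) \<in> \<int>" by simp
    have "2 ^ M * F ((real i + u) / 2 ^ N) =
        2 ^ M * F (real i / 2 ^ N) + 2 ^ nat (int M + e i) * u" if "u \<in> {0..1}" for u
      unfolding e[OF that] pow[symmetric] by (simp add: distrib_left)
    with int show "2 ^ M * F (real i / 2 ^ N) \<in> \<int> \<and> (\<exists>e::nat. \<forall>u\<in>{0..1}.
        2 ^ M * F ((real i + u) / 2 ^ N) = 2 ^ M * F (real i / 2 ^ N) + 2 ^ e * u)" by blast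
  qed simp
  then show thesis by (rule that)
qed

section \<open>The group law of T through lifts, and its generation\<close>

lemma thompson_T_mult:
  "g \<in> thompson_T_maps \<Longrightarrow> h \<in> thompson_T_maps \<Longrightarrow> g \<otimes>\<^bsub>thompson_T\<^esub> h = compose circle g h"
  by (auto simp: thompson_T_def BijGroup_def thompson_T_maps_def)

lemma carrier_thompson_T: "carrier thompson_T = thompson_T_maps"
  by (simp add: thompson_T_def)

lemma thompson_T_one_eq: "\<one>\<^bsub>thompson_T\<^esub> = (\<lambda>x\<in>circle. x)"
  by (simp add: thompson_T_def BijGroup_def)

lemma circle_map_mult:
  assumes "circle_map F \<in> thompson_T_maps" "circle_map G \<in> thompson_T_maps"
    and "\<And>x. F (x + 1) = F x + 1"
  shows "circle_map F \<otimes>\<^bsub>thompson_T\<^esub> circle_map G = circle_map (F \<circ> G)"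
proof -
  have "compose circle (circle_map F) (circle_map G) = circle_map (F \<circ> G)"
    using frac_periodic[of F, OF assms(3)] by (auto simp: compose_def circle_map_def)
  then show ?thesis using thompson_T_mult assms by simp
qed

lemma circle_map_pow:
  assumes F: "circle_map F \<in> thompson_T_maps" "\<And>x. F (x + 1) = F x + 1"
  shows "circle_map F [^]\<^bsub>thompson_T\<^esub> n = circle_map (F ^^ n)"
proof -
  interpret group thompson_T by (rule group_thompson_T)
  show ?thesis
  proof (induction n)
    case 0
    show ?case by (auto simp: thompson_T_one_eq circle_map_def)
  next
    case (Suc n)
    have mem: "circle_map F \<in> carrier thompson_T" using F by (simp add: carrier_thompson_T)
    have "circle_map F [^]\<^bsub>thompson_T\<^esub> Suc n =
        circle_map F \<otimes>\<^bsub>thompson_T\<^esub> (circle_map F [^]\<^bsub>thompson_T\<^esub> n)"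
      by (rule nat_pow_Suc2[OF mem])
    also have "\<dots> = circle_map F \<otimes>\<^bsub>thompson_T\<^esub> circle_map (F ^^ n)" using Suc by simp
    also have "\<dots> = circle_map (F ^^ Suc n)"
      using circle_map_mult[OF F(1) _ F(2), of "F ^^ n"] Suc nat_pow_closed[OF mem, of n]
      by (simp add: carrier_thompson_T o_def)
    finally show ?case .
  qed
qed

lemma circle_map_translation: "(\<And>x. F x = x + of_int k) \<Longrightarrow> circle_map F = \<one>\<^bsub>thompson_T\<^esub>"
  by (auto simp: circle_map_def thompson_T_one_eq frac_add_int_right)

lemma generate_thompson_T:
  "generate thompson_T {circle_map beta_lift, circle_map alpha_lift} = carrier thompson_T"
proof
  interpret group thompson_T by (rule group_thompson_T)
  let ?X = "{circle_map beta_lift, circle_map alpha_lift}"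
  define S where "S = generate thompson_T ?X"
  have X: "?X \<subseteq> carrier thompson_T"
    using beta_thompson_T alpha_thompson_T by (simp add: carrier_thompson_T)
  interpret S: subgroup S thompson_T unfolding S_def by (rule generate_is_subgroup[OF X])
  show "generate thompson_T ?X \<subseteq> carrier thompson_T" by (rule generate_incl[OF X])
  have ST: "S \<subseteq> thompson_T_maps" using S.subset by (simp add: carrier_thompson_T)
  \<comment> \<open>\<open>H\<close> takes every bijection of the line that covers an element of
    \<open>S\<close>, so its closure properties come directly from those of the subgroup.\<close>
  define H where "H = {F. bij F \<and> (\<exists>g\<in>S. \<forall>x. frac (F x) = g (frac x))}"
  have gen: "circle_map F \<in> S \<Longrightarrow> bij F \<Longrightarrow> (\<And>x. F (x + 1) = F x + 1) \<Longrightarrow> F \<in> H" for F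
    using frac_periodic[of F] by (auto simp: H_def)
  interpret lift_group H
  proof
    fix F F' assume F: "F \<in> H" "F' \<in> H"
    then obtain g g' where g: "g \<in> S" "\<forall>x. frac (F x) = g (frac x)"
        "g' \<in> S" "\<forall>x. frac (F' x) = g' (frac x)" by (auto simp: H_def)
    have "compose circle g g' \<in> S"
      using S.m_closed[OF g(1,3)] thompson_T_mult g ST by (metis subsetD)
    moreover have "\<forall>x. frac ((F \<circ> F') x) = compose circle g g' (frac x)"
      using g by (simp add: compose_def)
    ultimately show "F \<circ> F' \<in> H" using F by (auto simp: H_def bij_comp)
  next
    fix F assume F: "F \<in> H"
    then obtain g where g: "g \<in> S" "\<forall>x. frac (F x) = g (frac x)" by (auto simp: H_def)
    define h where "h = inv\<^bsub>thompson_T\<^esub> g"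
    have h: "h \<in> S" using g by (simp add: h_def)
    have "h \<otimes>\<^bsub>thompson_T\<^esub> g = \<one>\<^bsub>thompson_T\<^esub>" using g by (simp add: h_def l_inv)
    then have "compose circle h g = (\<lambda>x\<in>circle. x)"
      using thompson_T_mult g h ST thompson_T_one_eq by (metis subsetD)
    then have hg: "h (g x) = x" if "x \<in> circle" for x
      using that by (metis compose_eq restrict_apply')
    have bij: "bij F" using F by (simp add: H_def)
    define F' where "F' = inv_into UNIV F"
    have FF': "F (F' x) = x" for x using bij by (simp add: F'_def bij_is_surj surj_f_inv_f)
    have "frac (F' x) = h (frac x)" for x
      using g(2) hg[of "frac (F' x)"] FF' by (metis frac_in_circle)
    moreover have "bij F'" using bij by (simp add: F'_def bij_imp_bij_inv)
    ultimately have "F' \<in> H" using h by (auto simp: H_def)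
    then show "\<exists>F'\<in>H. \<forall>x. F (F' x) = x" using FF' by blast
  next
    show "beta_lift \<in> H" "alpha_lift \<in> H"
      using gen bij_beta_lift bij_alpha_lift beta_lift_shift[of _ 1] alpha_lift_shift[of _ 1]
      by (simp_all add: S_def generate.incl)
  qed
  show "carrier thompson_T \<subseteq> generate thompson_T ?X"
  proof
    fix g assume "g \<in> carrier thompson_T"
    then have g: "g \<in> thompson_T_maps" by (simp add: carrier_thompson_T)
    then obtain F B where F: "orientation_preserving_lift g F" "finite B" "B \<subseteq> circle_dyadics"
        "dyadic_PL_off B F" and gd: "g ` circle_dyadics \<subseteq> circle_dyadics"
      unfolding thompson_T_maps_def by auto
    obtain N M where "subdivision (2 ^ N) (2 ^ M) (\<lambda>x. 2 ^ M * F (x / 2 ^ N))"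
      using lift_subdivision[OF F(1,4,2,3) gd] .
    then have "F \<in> H" by (rule mem_if_subdivision)
    then obtain h where h: "h \<in> S" "\<forall>x. frac (F x) = h (frac x)" by (auto simp: H_def)
    \<comment> \<open>\<open>F\<close> covers both \<open>g\<close> and \<open>h\<close>, so they
      agree on the circle; extensionality then makes them equal.\<close>
    have "g x = h x" if "x \<in> circle" for x
      using h(2) F(1) that by (metis frac_circle orientation_preserving_lift_def)
    moreover have "g \<in> extensional circle" "h \<in> extensional circle"
      using g h ST by (auto simp: thompson_T_maps_def Bij_def)
    ultimately have "g = h" by (intro extensionalityI) auto
    then show "g \<in> generate thompson_T ?X" using h by (simp add: S_def)
  qed
qed

theorem theorem4p3:
  shows "property_FA TYPE('v) thompson_T"
proof -
  let ?b = "circle_map beta_lift" and ?a = "circle_map alpha_lift"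
  interpret group thompson_T by (rule group_thompson_T)
  have per: "beta_lift (x + 1) = beta_lift x + 1" "alpha_lift (x + 1) = alpha_lift x + 1" for x
    using beta_lift_shift[of x 1] alpha_lift_shift[of x 1] by simp_all
  have mem: "?b \<in> carrier thompson_T" "?a \<in> carrier thompson_T"
    using beta_thompson_T alpha_thompson_T by (simp_all add: carrier_thompson_T)
  have ba: "?b \<otimes>\<^bsub>thompson_T\<^esub> ?a = circle_map (beta_lift \<circ> alpha_lift)"
    by (rule circle_map_mult[OF beta_thompson_T alpha_thompson_T per(1)])
  then have ba_mem: "circle_map (beta_lift \<circ> alpha_lift) \<in> thompson_T_maps"
    using m_closed[OF mem] by (simp add: carrier_thompson_T)
  show ?thesis
  proof (rule property_FA_two_generators[OF group_thompson_T mem generate_thompson_T])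
    show "?b [^]\<^bsub>thompson_T\<^esub> (3::nat) = \<one>\<^bsub>thompson_T\<^esub>"
      unfolding circle_map_pow[of beta_lift, OF beta_thompson_T per(1)]
      by (rule circle_map_translation[of _ 1]) (simp add: beta_lift_power)
    show "?a [^]\<^bsub>thompson_T\<^esub> (4::nat) = \<one>\<^bsub>thompson_T\<^esub>"
      unfolding circle_map_pow[of alpha_lift, OF alpha_thompson_T per(2)]
      by (rule circle_map_translation[of _ 1]) (simp add: alpha_lift_power)
    have per_ba: "(beta_lift \<circ> alpha_lift) (x + 1) = (beta_lift \<circ> alpha_lift) x + 1" for x
      by (simp add: per)
    \<comment> \<open>The product rotates the pentagon by three of its five leaves, so its fifth
      power lifts to three full turns.\<close>
    show "(?b \<otimes>\<^bsub>thompson_T\<^esub> ?a) [^]\<^bsub>thompson_T\<^esub> (5::nat) = \<one>\<^bsub>thompson_T\<^esub>"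
      unfolding ba circle_map_pow[of "beta_lift \<circ> alpha_lift", OF ba_mem per_ba]
      by (rule circle_map_translation[of _ 3]) (simp add: beta_alpha_lift_power)
  qed simp_all
qed

end
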